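(* Consider the online problem and the algorithm O-DGT with true gradients described in the context. Assume: (1) each $X_i\subseteq\mathbb{R}^{n_i}$ is nonempty, convex and compact, and there is $B>0$ with $\|x_i\|\le B$ for all $x_i\in X_i$, $i\in[N]$; (2) $f_t:\mathbb{R}^n\to\mathbb{R}$ is convex for all $t\ge 0$; (3) there is $L_1$ such that $\|\nabla_1 f_t(x,y)-\nabla_1 f_t(x',y')\|\le L_1(\|x-x'\|+\|y-y'\|)$ and $\|\nabla_2 f_t(x,y)-\nabla_2 f_t(x',y')\|\le L_1(\|x-x'\|+\|y-y'\|)$ for all $x,x'\in X$, $y,y'\in\mathbb{R}^{Nd}$, $t\ge 0$; (4) there is $G>0$ such that $\|\nabla_1 f_t(x,y)\|\le G$, $\|\nabla_2 f_t(x,y)\|\le G$, $\|\nabla\psi_i(x_i)\|\le G$ for all $x\in X$, $y\in\mathbb{R}^{Nd}$, $t\ge 0$, $i\in[N]$; (5) there is $L_2$ such that $\|\nabla\psi_i(x)-\nabla\psi_i(x')\|\le L_2\|x-x'\|$ for all $x,x'\in X_i$, $i\in[N]$; (6) there is an integer $Q>0$ such that the union graph $(\mathcal{V},\bigcup_{l=0}^{Q-1}\mathcal{E}_{k+l})$ is strongly connected for every $k\ge 0$; (7) $A_t=(a_{ij,t})$ is doubly stochastic for every $t\ge 0$; (8) there is $a\in(0,1)$ such that, for all $t\ge0$, $a_{ij,t}\ge a$ whenever $a_{ij,t}>0$, and $a_{ii,t}\ge a$ for all $i\in[N]$. Define $$V_{T,1}^p=\sum_{t=1}^T\|x_{t+1}^*-x_t^*\|,\qquad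 V_T^g=\sum_{t=1}^T\sum_{i=1}^N\sup_{x_i\in X_i,\,z_i\in\mathbb{R}^d}\|\nabla_2f_{i,t+1}(x_i,z_i)-\nabla_2f_{i,t}(x_i,z_i)\|,$$ $$V_{T,1}^g=\sum_{t=1}^T\Big(\sum_{i=1}^N\sup_{x_i\in X_i,\,z_i\in\mathbb{R}^d}\|\nabla_2f_{i,t+1}(x_i,z_i)-\nabla_2f_{i,t}(x_i,z_i)\|\Big)^2.$$ For horizon $T$, run the algorithm with the constant stepsize $$\alpha_t=\sqrt{\frac{1+V_{T,1}^p}{T+V_{T,1}^g}}\qquad\text{for all } t\ge 0.$$ Then $$\mathcal{R}_T=O(\sqrt{T})+O\big(\sqrt{T\,V_{T,1}^p}\big)+O(V_T^g)+O\big(\sqrt{V_{T,1}^p\,V_{T,1}^g}\big).$$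
   Context: Notation: $[N]=\{1,\dots,N\}$; $col(z_1,\dots,z_k)$ stacks column vectors; $\|\cdot\|$ is the Euclidean norm (for matrices, the induced norm); $P_S$ is Euclidean projection onto a closed convex set $S$. Problem. There are $N$ agents; $n=\sum_{i=1}^N n_i$; $X_i\subseteq\mathbb{R}^{n_i}$, $X=\prod_{i=1}^N X_i$; $\psi_i:\mathbb{R}^{n_i}\to\mathbb{R}^d$ is differentiable. For $x=col(x_1,\dots,x_N)$ the aggregative variable is $\nu(x)=\frac1N\sum_{i=1}^N\psi_i(x_i)$. For each $t=0,1,2,\dots$ and $i\in[N]$ there is a differentiable local loss $f_{i,t}:\mathbb{R}^{n_i}\times\mathbb{R}^d\to\mathbb{R}$, and $f_t(x)=\sum_{i=1}^N f_{i,t}(x_i,\nu(x))$. $\nabla_1 f_{i,t}$ and $\nabla_2 f_{i,t}$ are the gradients in the first and second argument. For a vector-valued $g=col(g_1,\dots,g_m)$, $\nabla g=(\nabla g_1,\dots,\nabla g_m)$ (transposed Jacobian), so $\nabla\psi_i(x_i)\in\mathbb{R}^{n_i\times d}$. For $x\in\mathbb{R}^n$, $y=col(y_1,\dots,y_N)\in\mathbb{R}^{Nd}$ and $k=1,2$: $\nabla_k f_t(x,y)=col(\nabla_k f_{1,t}(x_1,y_1),\dots,\nabla_k f_{N,t}(x_N,y_N))$. Network. For each $t\ge0$, $\mathcal{G}_t=(\mathcal{V},\mathcal{E}_t)$ is a directed graph on $\mathcal{V}=[N]$ with matrix $A_t=(a_{ij,t})\in\mathbb{R}^{N\times N}$ with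 nonnegative entries; for $i\ne j$, $a_{ij,t}>0$ if $(j,i)\in\mathcal{E}_t$ and $a_{ij,t}=0$ otherwise. Algorithm (O-DGT with true gradients), stepsizes $\alpha_t>0$. Initialize $x_{i,0}\in X_i$ arbitrarily, $\nu_{i,0}=\psi_i(x_{i,0})$, $y_{i,0}=\nabla_2 f_{i,0}(x_{i,0},\nu_{i,0})$. For $t\ge 0$ and each $i\in[N]$: $x_{i,t+1}=P_{X_i}[x_{i,t}-\alpha_t(\nabla_1 f_{i,t}(x_{i,t},\nu_{i,t})+\nabla\psi_i(x_{i,t})y_{i,t})]$, $\nu_{i,t+1}=\sum_{j=1}^N a_{ij,t}\nu_{j,t}+\psi_i(x_{i,t+1})-\psi_i(x_{i,t})$, $y_{i,t+1}=\sum_{j=1}^N a_{ij,t}y_{j,t}+\nabla_2 f_{i,t+1}(x_{i,t+1},\nu_{i,t+1})-\nabla_2 f_{i,t}(x_{i,t},\nu_{i,t})$. Write $x_t=col(x_{1,t},\dots,x_{N,t})$. Dynamic regret: $\mathcal{R}_T=\sum_{t=1}^T f_t(x_t)-\sum_{t=1}^T f_t(x_t^* )$, where $x_t^*\in\arg\min_{x\in X}f_t(x)$ is a (fixed) minimizer. $O(\cdot)$ is with respect to the horizon $T\ge1$: implied constants do not depend on $T$ (they may depend on the other fixed parameters of the problem). *)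

theory Defs
  imports "HOL-Analysis.Analysis"
begin

text \<open>
  Agents are the elements of a finite type \<open>'v\<close> (so \<open>N = CARD('v)\<close>), and the aggregative variable
  lives in \<open>real^'d\<close>.  Since the agents' dimensions \<open>n\<^sub>i\<close> differ, the \<open>n = (\<Sum>i. n\<^sub>i)\<close> scalar
  coordinates are the elements of a finite type \<open>'n\<close>, and a map \<open>own :: 'n \<Rightarrow> 'v\<close> tells to which
  agent a coordinate belongs.  Thus \<open>n\<^sub>i\<close> is the number of \<open>k\<close> with \<open>own k = i\<close>, the space of stacked
  decisions is \<open>real^'n\<close>, and \<open>\<real>\<close>-vectors of dimension \<open>n\<^sub>i\<close> are the elements of
  \<open>block_space own i\<close>, i.e. they are padded by zeros outside the coordinates of agent \<open>i\<close>.
  Padding changes neither inner products nor Euclidean norms.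
\<close>

definition block_space :: "('n \<Rightarrow> 'v) \<Rightarrow> 'v \<Rightarrow> (real^'n) set" where
  "block_space own i = {u. \<forall>k. own k \<noteq> i \<longrightarrow> u $ k = 0}"

definition block :: "('n \<Rightarrow> 'v) \<Rightarrow> 'v \<Rightarrow> real^'n \<Rightarrow> real^'n" where
  "block own i x = (\<chi> k. if own k = i then x $ k else 0)"

definition col :: "('n \<Rightarrow> 'v) \<Rightarrow> ('v \<Rightarrow> real^'n) \<Rightarrow> real^'n" where
  "col own u = (\<chi> k. u (own k) $ k)"

text \<open>
  A function on the space of agent \<open>i\<close> is represented by the function on \<open>real^'n\<close> that reads only
  the coordinates of agent \<open>i\<close>.  Its gradient then has zero entries outside these coordinates
  (lemma \<open>gradient_in_block_space\<close>), so it is again the padded form of the gradient on \<open>n\<^sub>i\<close>-space.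
\<close>

definition depends_on_block :: "('n \<Rightarrow> 'v) \<Rightarrow> 'v \<Rightarrow> (real^'n \<Rightarrow> 'b) \<Rightarrow> bool" where
  "depends_on_block own i g \<longleftrightarrow> (\<forall>x. g (block own i x) = g x)"

definition joint_set :: "('n \<Rightarrow> 'v) \<Rightarrow> ('v \<Rightarrow> (real^'n) set) \<Rightarrow> (real^'n) set" where
  "joint_set own X = {x. \<forall>i. block own i x \<in> X i}"

definition gradient :: "('a::real_inner \<Rightarrow> real) \<Rightarrow> 'a \<Rightarrow> 'a" where
  "gradient g x = (THE D. GDERIV g x :> D)"

definition grad1 :: "('a::real_inner \<Rightarrow> 'b::real_inner \<Rightarrow> real) \<Rightarrow> 'a \<Rightarrow> 'b \<Rightarrow> 'a" where
  "grad1 g u z = gradient (\<lambda>u'. g u' z) u"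

definition grad2 :: "('a::real_inner \<Rightarrow> 'b::real_inner \<Rightarrow> real) \<Rightarrow> 'a \<Rightarrow> 'b \<Rightarrow> 'b" where
  "grad2 g u z = gradient (\<lambda>z'. g u z') z"

definition nabla :: "(real^'n \<Rightarrow> real^'d) \<Rightarrow> real^'n \<Rightarrow> real^'d^'n" where
  "nabla g u = transpose (jacobian g (at u))"

abbreviation matrix_norm :: "real^'d^'n \<Rightarrow> real" where
  "matrix_norm M \<equiv> onorm (\<lambda>v. M *v v)"

lemma gradient_eq:
  fixes g :: "'a::real_inner \<Rightarrow> real"
  assumes "GDERIV g x :> D"
  shows "gradient g x = D"
  unfolding gradient_def
proof (rule the_equality[where P = "\<lambda>D. GDERIV g x :> D"])
  show "GDERIV g x :> D" by fact
next
  fix D' assume "GDERIV g x :> D'"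
  then have eq: "(\<lambda>h. h \<bullet> D') = (\<lambda>h. h \<bullet> D)"
    using assms unfolding gderiv_def by (rule has_derivative_unique)
  have "(D' - D) \<bullet> (D' - D) = 0"
    using fun_cong[OF eq, of "D' - D"] by (simp only: inner_diff_right diff_self)
  then show "D' = D" by simp
qed

lemma gradient_works:
  fixes g :: "'a::euclidean_space \<Rightarrow> real"
  assumes "g differentiable (at x)"
  shows "GDERIV g x :> gradient g x"
proof -
  obtain L where L: "(g has_derivative L) (at x)"
    using assms by (auto simp: differentiable_def)
  have "linear L" using L by (rule has_derivative_linear)
  then have "L h = h \<bullet> adjoint L 1" for h
    using adjoint_works[of L h 1] by simp
  then have "L = (\<lambda>h. h \<bullet> adjoint L 1)" by (rule ext)
  then have "GDERIV g x :> adjoint L 1"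
    using L unfolding gderiv_def by simp
  then show ?thesis by (simp add: gradient_eq)
qed

lemma gradient_in_block_space:
  fixes g :: "real^'n \<Rightarrow> real"
  assumes "depends_on_block own i g" "g differentiable (at x)"
  shows "gradient g x \<in> block_space own i"
  unfolding block_space_def
proof (intro CollectI allI impI)
  fix k assume k: "own k \<noteq> i"
  let ?p = "\<lambda>s::real. x + s *\<^sub>R axis k 1"
  have "(g has_derivative (\<lambda>h. h \<bullet> gradient g x)) (at (?p 0))"
    using gradient_works[OF assms(2)] by (simp add: gderiv_def)
  moreover have "(?p has_derivative (\<lambda>s. 0 + s *\<^sub>R axis k 1)) (at 0)"
    by (intro has_derivative_add has_derivative_const has_derivative_scaleR_left has_derivative_ident)
  ultimately have deriv:
    "((\<lambda>s. g (?p s)) has_derivative (\<lambda>s. (0 + s *\<^sub>R axis k 1) \<bullet> gradient g x)) (at 0)"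
    by (rule has_derivative_compose[rotated])
  have "g (?p s) = g x" for s
  proof -
    have "block own i (?p s) = block own i x"
      using k by (simp add: block_def vec_eq_iff axis_def)
    then show ?thesis
      using assms(1) unfolding depends_on_block_def by metis
  qed
  then have "((\<lambda>s::real. g x) has_derivative (\<lambda>s. (0 + s *\<^sub>R axis k 1) \<bullet> gradient g x)) (at 0)"
    using deriv by (simp only:)
  from fun_cong[OF has_derivative_unique[OF this has_derivative_const], of 1]
  show "gradient g x $ k = 0"
    by (simp add: inner_axis')
qed

definition aggregate :: "('n \<Rightarrow> 'v) \<Rightarrow> ('v::finite \<Rightarrow> real^'n \<Rightarrow> real^'d) \<Rightarrow> real^'n \<Rightarrow> real^'d" where
  "aggregate own \<psi> x = (1 / real CARD('v)) *\<^sub>R (\<Sum>i\<in>UNIV. \<psi> i (block own i x))"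

definition total_loss :: "('n \<Rightarrow> 'v) \<Rightarrow> ('v::finite \<Rightarrow> real^'n \<Rightarrow> real^'d) \<Rightarrow>
    ('v \<Rightarrow> nat \<Rightarrow> real^'n \<Rightarrow> real^'d \<Rightarrow> real) \<Rightarrow> nat \<Rightarrow> real^'n \<Rightarrow> real" where
  "total_loss own \<psi> f t x = (\<Sum>i\<in>UNIV. f i t (block own i x) (aggregate own \<psi> x))"

definition stacked_grad1 :: "('n::finite \<Rightarrow> 'v) \<Rightarrow>
    ('v \<Rightarrow> nat \<Rightarrow> real^'n \<Rightarrow> real^'d \<Rightarrow> real) \<Rightarrow> nat \<Rightarrow> real^'n \<Rightarrow> real^'d^'v \<Rightarrow> real^'n" where
  "stacked_grad1 own f t x y = col own (\<lambda>i. grad1 (f i t) (block own i x) (y $ i))"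

definition stacked_grad2 :: "('n::finite \<Rightarrow> 'v) \<Rightarrow>
    ('v \<Rightarrow> nat \<Rightarrow> real^'n \<Rightarrow> real^'d \<Rightarrow> real) \<Rightarrow> nat \<Rightarrow> real^'n \<Rightarrow> real^'d^'v \<Rightarrow> real^'d^'v" where
  "stacked_grad2 own f t x y = (\<chi> i. grad2 (f i t) (block own i x) (y $ i))"

definition doubly_stochastic :: "real^'v^'v \<Rightarrow> bool" where
  "doubly_stochastic M \<longleftrightarrow> (\<forall>i j. M $ i $ j \<ge> 0) \<and>
     (\<forall>i. (\<Sum>j\<in>UNIV. M $ i $ j) = 1) \<and> (\<forall>j. (\<Sum>i\<in>UNIV. M $ i $ j) = 1)"

definition odgt_run :: "('v \<Rightarrow> (real^'n) set) \<Rightarrow> ('v::finite \<Rightarrow> real^'n \<Rightarrow> real^'d) \<Rightarrow>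
    ('v \<Rightarrow> nat \<Rightarrow> real^'n \<Rightarrow> real^'d \<Rightarrow> real) \<Rightarrow> (nat \<Rightarrow> real^'v^'v) \<Rightarrow> (nat \<Rightarrow> real) \<Rightarrow>
    (nat \<Rightarrow> 'v \<Rightarrow> real^'n) \<Rightarrow> (nat \<Rightarrow> 'v \<Rightarrow> real^'d) \<Rightarrow> (nat \<Rightarrow> 'v \<Rightarrow> real^'d) \<Rightarrow> bool" where
  "odgt_run X \<psi> f A \<alpha> x \<nu> y \<longleftrightarrow>
     (\<forall>i. x 0 i \<in> X i \<and> \<nu> 0 i = \<psi> i (x 0 i) \<and> y 0 i = grad2 (f i 0) (x 0 i) (\<nu> 0 i)) \<and>
     (\<forall>t i.
        x (Suc t) i = closest_point (X i)
          (x t i - \<alpha> t *\<^sub>R (grad1 (f i t) (x t i) (\<nu> t i) + nabla (\<psi> i) (x t i) *v y t i)) \<and>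
        \<nu> (Suc t) i = (\<Sum>j\<in>UNIV. (A t $ i $ j) *\<^sub>R \<nu> t j) + \<psi> i (x (Suc t) i) - \<psi> i (x t i) \<and>
        y (Suc t) i = (\<Sum>j\<in>UNIV. (A t $ i $ j) *\<^sub>R y t j)
          + grad2 (f i (Suc t)) (x (Suc t) i) (\<nu> (Suc t) i) - grad2 (f i t) (x t i) (\<nu> t i))"

definition dynamic_regret :: "('n \<Rightarrow> 'v) \<Rightarrow> ('v::finite \<Rightarrow> real^'n \<Rightarrow> real^'d) \<Rightarrow>
    ('v \<Rightarrow> nat \<Rightarrow> real^'n \<Rightarrow> real^'d \<Rightarrow> real) \<Rightarrow> (nat \<Rightarrow> real^'n) \<Rightarrow> (nat \<Rightarrow> 'v \<Rightarrow> real^'n) \<Rightarrow>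
    nat \<Rightarrow> real" where
  "dynamic_regret own \<psi> f xstar x T =
     (\<Sum>t=1..T. total_loss own \<psi> f t (col own (x t))) - (\<Sum>t=1..T. total_loss own \<psi> f t (xstar t))"

definition path_variation :: "(nat \<Rightarrow> real^'n) \<Rightarrow> nat \<Rightarrow> real" where
  "path_variation xstar T = (\<Sum>t=1..T. norm (xstar (t + 1) - xstar t))"

text \<open>
  The supremum below is a real one; it is only meaningful if the gradient differences are bounded,
  which follows from uniformly bounded gradients.
\<close>

definition grad_drift :: "('v::finite \<Rightarrow> (real^'n) set) \<Rightarrow>
    ('v \<Rightarrow> nat \<Rightarrow> real^'n \<Rightarrow> real^'d \<Rightarrow> real) \<Rightarrow> nat \<Rightarrow> real" where
  "grad_drift X f t = (\<Sum>i\<in>UNIV. SUP (u, z)\<in>X i \<times> UNIV.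
     norm (grad2 (f i (t + 1)) u z - grad2 (f i t) u z))"

definition grad_variation :: "('v::finite \<Rightarrow> (real^'n) set) \<Rightarrow>
    ('v \<Rightarrow> nat \<Rightarrow> real^'n \<Rightarrow> real^'d \<Rightarrow> real) \<Rightarrow> nat \<Rightarrow> real" where
  "grad_variation X f T = (\<Sum>t=1..T. grad_drift X f t)"

definition grad_variation_sq :: "('v::finite \<Rightarrow> (real^'n) set) \<Rightarrow>
    ('v \<Rightarrow> nat \<Rightarrow> real^'n \<Rightarrow> real^'d \<Rightarrow> real) \<Rightarrow> nat \<Rightarrow> real" where
  "grad_variation_sq X f T = (\<Sum>t=1..T. (grad_drift X f t)\<^sup>2)"

end

theory Submission
  imports Defs
begin

text \<open>
  Since the losses are convex, the regret in round \<open>t\<close> is at most the inner product of the gradient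
  of \<open>f\<^sub>t\<close> with \<open>x\<^sub>t - x\<^sub>t\<^sup>*\<close>.  Replacing this gradient by the direction used by the algorithm, the
  projected step telescopes and contributes terms of order \<open>(1 + V\<^sup>p) / \<alpha>\<close> and \<open>\<alpha> * T\<close>.  The price is
  the disagreement among the agents' \<open>\<nu>\<close> and \<open>y\<close>, measured by their diameters.  Over \<open>N * Q\<close> rounds the
  product of the weight matrices has all entries at least \<open>a ^ (N * Q)\<close> and therefore contracts
  diameters, so the accumulated disagreement is bounded by the accumulated perturbations of the
  averaging: these are of order \<open>\<alpha>\<close> for \<open>\<nu>\<close>, and of order \<open>\<alpha>\<close> plus the disagreement of \<open>\<nu>\<close> plus the
  gradient drift for \<open>y\<close>.
\<close>

section \<open>Perturbed averaging\<close>

definition spread :: "('v::finite \<Rightarrow> 'b::real_normed_vector) \<Rightarrow> real" where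
  "spread v = (MAX (i, j)\<in>UNIV. norm (v i - v j))"

lemma norm_diff_le_spread: "norm (v i - v j) \<le> spread v"
  unfolding spread_def by (rule Max_ge) (auto intro!: image_eqI[of _ _ "(i, j)"])

lemma spread_leI: "(\<And>i j. norm (v i - v j) \<le> c) \<Longrightarrow> spread v \<le> c"
  unfolding spread_def by (subst Max_le_iff) auto

lemma spread_nonneg: "0 \<le> spread v"
  using norm_diff_le_spread[of v undefined undefined] by simp

lemma spread_le_add:
  assumes "\<And>i. norm (v i - w i) \<le> c"
  shows "spread v \<le> spread w + 2 * c"
proof (rule spread_leI)
  fix i j
  have "norm (v i - v j) = norm ((w i - w j) + ((v i - w i) - (v j - w j)))"
    by (simp add: algebra_simps)
  also have "\<dots> \<le> norm (w i - w j) + (norm (v i - w i) + norm (v j - w j))"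
    by (rule order_trans[OF norm_triangle_ineq add_left_mono[OF norm_triangle_ineq4]])
  finally show "norm (v i - v j) \<le> spread w + 2 * c"
    using assms[of i] assms[of j] norm_diff_le_spread[of w i j] by simp
qed

text \<open>Balls are convex: as the weights sum to 1, \<open>z\<close> minus the average is the
  average of the differences \<open>z - v j\<close>. Taking \<open>z = 0\<close> bounds the norm of
  an average.\<close>

lemma norm_diff_weighted_sum_le:
  fixes v :: "'v::finite \<Rightarrow> 'b::real_normed_vector"
  assumes "\<And>j. 0 \<le> q j" "sum q UNIV = 1" "\<And>j. norm (z - v j) \<le> c"
  shows "norm (z - (\<Sum>j\<in>UNIV. q j *\<^sub>R v j)) \<le> c"
proof -
  have "z - (\<Sum>j\<in>UNIV. q j *\<^sub>R v j) = (\<Sum>j\<in>UNIV. q j *\<^sub>R (z - v j))"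
    by (simp add: scaleR_diff_right sum_subtractf assms(2) flip: scaleR_sum_left)
  also have "norm \<dots> \<le> (\<Sum>j\<in>UNIV. q j * c)"
    by (rule sum_norm_le) (simp add: assms mult_left_mono)
  also have "\<dots> = c" by (simp add: assms(2) flip: sum_distrib_right)
  finally show ?thesis .
qed

lemma norm_diff_mean_le_spread:
  fixes v :: "'v::finite \<Rightarrow> 'b::real_normed_vector"
  shows "norm (v i - (1 / real CARD('v)) *\<^sub>R (\<Sum>j\<in>UNIV. v j)) \<le> spread v"
  using norm_diff_weighted_sum_le[of "\<lambda>_. 1 / real CARD('v)" "v i" v "spread v"]
  by (simp add: norm_diff_le_spread scaleR_sum_right)

text \<open>Dobrushin's contraction: the part \<open>\<delta>\<close> of the mass that two rows have in common at every
  column cancels in the difference.\<close>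
lemma spread_contraction:
  fixes P :: "real^'v::finite^'v" and v :: "'v \<Rightarrow> 'b::real_normed_vector"
  assumes rows: "\<And>i. (\<Sum>j\<in>UNIV. P $ i $ j) = 1"
    and low: "\<And>i j. \<delta> \<le> P $ i $ j" and "0 \<le> \<delta>"
  shows "spread (\<lambda>i. \<Sum>j\<in>UNIV. P $ i $ j *\<^sub>R v j) \<le> (1 - \<delta>) * spread v"
proof (rule spread_leI)
  fix i k
  \<comment> \<open>Removing \<open>\<delta>\<close> from every entry leaves rows \<open>q\<close>
    of equal mass \<open>c\<close>; the removed parts of two rows agree.\<close>
  define c where "c = 1 - real CARD('v) * \<delta>"
  define q where "q i j = P $ i $ j - \<delta>" for i j
  have q: "0 \<le> q i j" for i j using low by (simp add: q_def)
  have qs: "(\<Sum>j\<in>UNIV. q i j) = c" for i by (simp add: q_def sum_subtractf rows c_def)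
  have c0: "0 \<le> c" using qs[of i] sum_nonneg[of UNIV "q i"] q by auto
  let ?D = "(\<Sum>j\<in>UNIV. P $ i $ j *\<^sub>R v j) - (\<Sum>j\<in>UNIV. P $ k $ j *\<^sub>R v j)"
  have D: "?D = (\<Sum>j\<in>UNIV. q i j *\<^sub>R v j) - (\<Sum>j\<in>UNIV. q k j *\<^sub>R v j)"
    by (simp add: q_def scaleR_diff_left sum_subtractf)
  have "norm ?D \<le> c * spread v"
  \<comment> \<open>If \<open>c = 0\<close>, all remainders vanish. Otherwise division by
    \<open>c\<close> turns them into averages, and two averages of one family are at most its
    diameter apart.\<close>
  proof (cases "c = 0")
    case True
    then have "q i j = 0" for i j
      using qs[of i] q sum_nonneg_eq_0_iff[of UNIV "q i"] by auto
    then show ?thesis by (simp add: D True)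
  next
    case False
    with c0 have "c > 0" by simp
    have "norm ((\<Sum>j\<in>UNIV. (q i j / c) *\<^sub>R v j) - (\<Sum>j\<in>UNIV. (q k j / c) *\<^sub>R v j)) \<le> spread v"
    proof (rule norm_diff_weighted_sum_le)
      fix j
      have "norm (v j - (\<Sum>j\<in>UNIV. (q i j / c) *\<^sub>R v j)) \<le> spread v"
        by (rule norm_diff_weighted_sum_le)
          (use q c0 False in \<open>simp_all add: norm_diff_le_spread qs flip: sum_divide_distrib\<close>)
      then show "norm ((\<Sum>j\<in>UNIV. (q i j / c) *\<^sub>R v j) - v j) \<le> spread v"
        by (simp add: norm_minus_commute)
    qed (use q c0 False in \<open>simp_all add: qs flip: sum_divide_distrib\<close>)
    moreover have "(\<Sum>j\<in>UNIV. (q i j / c) *\<^sub>R v j) - (\<Sum>j\<in>UNIV. (q k j / c) *\<^sub>R v j) = (1 / c) *\<^sub>R ?D"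
      by (simp add: D scaleR_diff_right scaleR_sum_right)
    ultimately have "norm ?D / c \<le> spread v" using c0 by simp
    then show ?thesis using \<open>c > 0\<close> by (simp add: field_simps)
  qed
  also have "c \<le> 1 - \<delta>"
  proof -
    have "1 * \<delta> \<le> real CARD('v) * \<delta>"
      by (rule mult_right_mono) (use \<open>0 \<le> \<delta>\<close> in \<open>auto simp: Suc_leI\<close>)
    then show ?thesis by (simp add: c_def)
  qed
  then have "c * spread v \<le> (1 - \<delta>) * spread v"
    by (rule mult_right_mono) (rule spread_nonneg)
  finally show "norm ?D \<le> (1 - \<delta>) * spread v" .
qed

section \<open>Doubly stochastic weights on a jointly connected network\<close>

locale consensus_weights =
  fixes A :: "nat \<Rightarrow> real^'v::finite^'v" and E :: "nat \<Rightarrow> ('v \<times> 'v) set" and Q :: nat and a :: real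
  assumes weights_edge: "\<And>t i j. i \<noteq> j \<Longrightarrow> (j, i) \<in> E t \<Longrightarrow> A t $ i $ j > 0"
    and Q_pos: "Q > 0"
    and connected: "\<And>k i j. (i, j) \<in> (\<Union>l\<in>{0..Q-1}. E (k + l))\<^sup>*"
    and stochastic: "\<And>t. doubly_stochastic (A t)"
    and a_pos: "0 < a" and a_less_1: "a < 1"
    and weights_ge: "\<And>t i j. A t $ i $ j > 0 \<Longrightarrow> A t $ i $ j \<ge> a"
    and diag_ge: "\<And>t i. A t $ i $ i \<ge> a"
begin

lemma A_nonneg: "0 \<le> A t $ i $ j" and A_rows: "(\<Sum>j\<in>UNIV. A t $ i $ j) = 1"
  and A_columns: "(\<Sum>i\<in>UNIV. A t $ i $ j) = 1"
  using stochastic by (auto simp: doubly_stochastic_def)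

text \<open>Unit column sums conserve the total; this is what makes the means of the tracking
  variables exact.\<close>

lemma sum_average:
  fixes v :: "'v \<Rightarrow> 'b::real_vector"
  shows "(\<Sum>i\<in>UNIV. \<Sum>j\<in>UNIV. A t $ i $ j *\<^sub>R v j) = (\<Sum>j\<in>UNIV. v j)"
proof -
  have "(\<Sum>i\<in>UNIV. \<Sum>j\<in>UNIV. A t $ i $ j *\<^sub>R v j) = (\<Sum>j\<in>UNIV. (\<Sum>i\<in>UNIV. A t $ i $ j) *\<^sub>R v j)"
    unfolding scaleR_sum_left by (rule sum.swap)
  then show ?thesis by (simp add: A_columns)
qed

text \<open>This is the product \<open>A (k + s - 1) ** ... ** A k\<close>, newest matrix on the
  left, which carries the values of round \<open>k\<close> to round \<open>k + s\<close>.\<close>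

fun transition :: "nat \<Rightarrow> nat \<Rightarrow> real^'v^'v" where
  "transition k 0 = mat 1"
| "transition k (Suc s) = A (k + s) ** transition k s"

lemma transition_Suc: "transition k (Suc s) $ i $ j = (\<Sum>p\<in>UNIV. A (k + s) $ i $ p * transition k s $ p $ j)"
  by (simp add: matrix_matrix_mult_def)

lemma transition_nonneg: "0 \<le> transition k s $ i $ j"
  by (induction s arbitrary: i) (auto simp: mat_def matrix_matrix_mult_def intro!: sum_nonneg mult_nonneg_nonneg A_nonneg)

lemma transition_rows: "(\<Sum>j\<in>UNIV. transition k s $ i $ j) = 1"
proof (induction s arbitrary: i)
  case 0 then show ?case by (simp add: mat_def)
next
  case (Suc s)
  have "(\<Sum>j\<in>UNIV. transition k (Suc s) $ i $ j)
      = (\<Sum>p\<in>UNIV. A (k + s) $ i $ p * (\<Sum>j\<in>UNIV. transition k s $ p $ j))"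
    unfolding transition_Suc sum_distrib_left by (rule sum.swap)
  then show ?case by (simp add: Suc.IH A_rows)
qed

lemma transition_pos_step:
  assumes "A (k + s) $ i $ p > 0" "transition k s $ p $ j > 0"
  shows "transition k (Suc s) $ i $ j > 0"
proof -
  have "A (k + s) $ i $ p * transition k s $ p $ j \<le> transition k (Suc s) $ i $ j"
    unfolding transition_Suc
    by (rule member_le_sum) (auto intro!: mult_nonneg_nonneg A_nonneg transition_nonneg)
  then show ?thesis using mult_pos_pos[OF assms] by linarith
qed

text \<open>A positive entry contains a positive product of weights along some walk of
  \<open>s\<close> steps, and each factor of that product is at least \<open>a\<close>.\<close>

lemma transition_ge:
  "transition k s $ i $ j > 0 \<Longrightarrow> transition k s $ i $ j \<ge> a ^ s"
proof (induction s arbitrary: i)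
  case 0 then show ?case by (simp add: mat_def split: if_splits)
next
  case (Suc s)
  have "\<exists>p. A (k + s) $ i $ p * transition k s $ p $ j > 0"
  proof (rule ccontr)
    assume "\<not> ?thesis"
    then have "transition k (Suc s) $ i $ j \<le> 0"
      unfolding transition_Suc by (intro sum_nonpos) (auto simp: not_less)
    with Suc.prems show False by simp
  qed
  then obtain p where p: "A (k + s) $ i $ p > 0" "transition k s $ p $ j > 0"
    using A_nonneg transition_nonneg by (metis less_eq_real_def mult_zero_left mult_zero_right less_irrefl)
  have "a * a ^ s \<le> A (k + s) $ i $ p * transition k s $ p $ j"
    using p a_pos by (intro mult_mono weights_ge Suc.IH) auto
  also have "\<dots> \<le> transition k (Suc s) $ i $ j"
    unfolding transition_Suc
    by (rule member_le_sum) (auto intro!: mult_nonneg_nonneg A_nonneg transition_nonneg)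
  finally show ?case by simp
qed

text \<open>These agents are the ones whose averages, \<open>s\<close> rounds later, give positive
  weight to the value of \<open>j\<close> in round \<open>k\<close>.\<close>

definition reached :: "nat \<Rightarrow> 'v \<Rightarrow> nat \<Rightarrow> 'v set" where
  "reached k j s = {i. transition k s $ i $ j > 0}"

text \<open>Positive diagonal weights let every agent keep a share of what it already holds.\<close>

lemma reached_mono: "s \<le> s' \<Longrightarrow> reached k j s \<subseteq> reached k j s'"
proof (rule lift_Suc_mono_le[of "reached k j"])
  fix s show "reached k j s \<subseteq> reached k j (Suc s)"
  proof
    fix i assume "i \<in> reached k j s"
    then show "i \<in> reached k j (Suc s)"
      using transition_pos_step[of k s i i j] less_le_trans[OF a_pos diag_ge] by (simp add: reached_def)
  qed
qed

lemma reached_start: "j \<in> reached k j 0"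
  by (simp add: reached_def mat_def)

text \<open>If \<open>Q\<close> rounds bring in no new agent, the set is constant throughout them
  and hence closed under all edges of the union graph. As it contains \<open>j\<close>, strong
  connectivity makes it everything.\<close>

lemma reached_grows:
  assumes "reached k j (s + Q) = reached k j s"
  shows "reached k j s = UNIV"
proof -
  have eq: "reached k j (s + l) = reached k j s" if "l \<le> Q" for l
    using reached_mono[of s "s + l" k j] reached_mono[of "s + l" "s + Q" k j] that assms by auto
  have edge_closed: "i \<in> reached k j s"
    if "p \<in> reached k j s" "(p, i) \<in> (\<Union>l\<in>{0..Q-1}. E ((k + s) + l))" for p i
  proof -
    from that(2) obtain l where l: "l \<le> Q - 1" "(p, i) \<in> E (k + s + l)" by auto
    have "p \<in> reached k j (s + l)" using eq[of l] l that(1) by auto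
    \<comment> \<open>The case \<open>i = p\<close> of a self-loop is covered by the diagonal bound,
      since \<open>weights_edge\<close> speaks of distinct agents.\<close>
    moreover have "A (k + s + l) $ i $ p > 0"
      using weights_edge[of i p] diag_ge[of "k + s + l" i] a_pos l by (cases "i = p") auto
    ultimately have "i \<in> reached k j (Suc (s + l))"
      using transition_pos_step[of k "s + l" i p j] by (simp add: reached_def add.assoc)
    \<comment> \<open>With \<open>Q > 0\<close>, \<open>l \<le> Q - 1\<close> gives
      \<open>Suc l \<le> Q\<close>, so the round after the edge is used still belongs to the
      constant stretch.\<close>
    then show ?thesis using eq[of "Suc l"] l Q_pos by simp
  qed
  have "i \<in> reached k j s" for i
    using connected[of j i "k + s"]
  proof (induction rule: rtrancl_induct)
    case base
    then show ?case using reached_start reached_mono[of 0 s] by blast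
  next
    case (step p i)
    then show ?case using edge_closed by blast
  qed
  then show ?thesis by blast
qed

text \<open>Each block of \<open>Q\<close> rounds adds at least one agent until none is missing;
  \<open>j\<close> itself counts at the start, whence \<open>Suc m\<close>.\<close>

lemma card_reached: "min CARD('v) (Suc m) \<le> card (reached k j (m * Q))"
proof (induction m)
  case 0
  have "card (reached k j 0) > 0" using reached_start by (auto simp: card_gt_0_iff)
  then show ?case by simp
next
  case (Suc m)
  show ?case
  proof (cases "reached k j (m * Q + Q) = reached k j (m * Q)")
    case True
    then have "reached k j (Suc m * Q) = UNIV"
      using reached_grows[of k j "m * Q"] by (simp add: add.commute)
    then show ?thesis by simp
  next
    case False
    then have "reached k j (m * Q) \<subset> reached k j (m * Q + Q)"
      using reached_mono[of "m * Q" "m * Q + Q" k j] by auto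
    then have "card (reached k j (m * Q)) < card (reached k j (m * Q + Q))"
      by (intro psubset_card_mono) auto
    then show ?thesis using Suc by (simp add: add.commute)
  qed
qed

definition window :: nat where "window = CARD('v) * Q"

lemma transition_window_ge: "a ^ window \<le> transition k window $ i $ j"
proof -
  have "CARD('v) \<le> card (reached k j window)"
    using card_reached[of "CARD('v)" k j] by (simp add: window_def)
  then have "reached k j window = UNIV" by (simp add: card_seteq)
  then show ?thesis using transition_ge unfolding reached_def by blast
qed

text \<open>The window length is divided by the contraction gap, so that
  \<open>M = 2 * mixing * U\<close> solves
  \<open>M = (1 - a ^ window) * M + 2 * window * U\<close>.\<close>

definition mixing :: real where "mixing = real window / a ^ window"

lemma window_pos: "window \<ge> 1" using Q_pos by (simp add: window_def Suc_leI)

lemma power_window: "0 < a ^ window" "a ^ window \<le> 1"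
  using a_pos a_less_1 by (auto intro: power_le_one)

lemma mixing_nonneg: "0 \<le> mixing" using power_window by (simp add: mixing_def)

lemma mixing_mult: "a ^ window * mixing = real window" using a_pos by (simp add: mixing_def)

lemma window_le_mixing: "real window \<le> mixing"
  using power_window mult_left_le[of "a ^ window" "real window"]
  unfolding mixing_def by (simp only: pos_le_divide_eq of_nat_0_le_iff)

end

section \<open>Diameters along a perturbed averaging recursion\<close>

locale perturbed_consensus = consensus_weights A E Q a
  for A :: "nat \<Rightarrow> real^'v::finite^'v" and E Q a +
  fixes v :: "nat \<Rightarrow> 'v \<Rightarrow> 'b::real_normed_vector" and b :: "nat \<Rightarrow> real"
  assumes perturbation: "\<And>t i. norm (v (Suc t) i - (\<Sum>j\<in>UNIV. A t $ i $ j *\<^sub>R v t j)) \<le> b t"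
begin

lemma b_nonneg: "0 \<le> b t"
  by (rule order_trans[OF norm_ge_zero perturbation[of t undefined]])

text \<open>Row-stochastic averaging never amplifies earlier errors, so the perturbations merely add
  up.\<close>

lemma norm_diff_transition_le:
  "norm (v (k + s) i - (\<Sum>j\<in>UNIV. transition k s $ i $ j *\<^sub>R v k j)) \<le> (\<Sum>l<s. b (k + l))"
proof (induction s arbitrary: i)
  case 0
  then show ?case by (simp add: mat_def if_distrib[of "\<lambda>c. c *\<^sub>R _"] cong: if_cong)
next
  case (Suc s)
  let ?h = "\<lambda>p. \<Sum>j\<in>UNIV. transition k s $ p $ j *\<^sub>R v k j"
  have "(\<Sum>j\<in>UNIV. transition k (Suc s) $ i $ j *\<^sub>R v k j) = (\<Sum>p\<in>UNIV. A (k + s) $ i $ p *\<^sub>R ?h p)"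
    unfolding transition_Suc scaleR_sum_left scaleR_sum_right by (subst sum.swap) simp
  then have "v (k + Suc s) i - (\<Sum>j\<in>UNIV. transition k (Suc s) $ i $ j *\<^sub>R v k j)
    = (v (Suc (k + s)) i - (\<Sum>p\<in>UNIV. A (k + s) $ i $ p *\<^sub>R v (k + s) p))
      + (\<Sum>p\<in>UNIV. A (k + s) $ i $ p *\<^sub>R (v (k + s) p - ?h p))"
    by (simp add: scaleR_diff_right sum_subtractf)
  also have "norm \<dots> \<le> b (k + s) + (\<Sum>p\<in>UNIV. A (k + s) $ i $ p * (\<Sum>l<s. b (k + l)))"
    by (intro norm_triangle_mono perturbation sum_norm_le)
      (auto intro!: mult_mono Suc.IH A_nonneg)
  also have "\<dots> = (\<Sum>l<Suc s. b (k + l))"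
    by (simp add: A_rows flip: sum_distrib_right)
  finally show ?case .
qed

lemma spread_transition_le:
  "spread (v (k + s)) \<le> spread (\<lambda>i. \<Sum>j\<in>UNIV. transition k s $ i $ j *\<^sub>R v k j) + 2 * (\<Sum>l<s. b (k + l))"
  by (rule spread_le_add) (rule norm_diff_transition_le)

text \<open>This is the contraction with \<open>\<delta> = 0\<close>, available for any number of
  rounds; it serves the rounds before a full window has passed.\<close>

lemma spread_step: "spread (v (k + s)) \<le> spread (v k) + 2 * (\<Sum>l<s. b (k + l))"
  using spread_transition_le[of k s] spread_contraction[of "transition k s" 0 "v k"]
    transition_nonneg transition_rows by fastforce

lemma spread_window_step:
  "spread (v (k + window)) \<le> (1 - a ^ window) * spread (v k) + 2 * (\<Sum>l<window. b (k + l))"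
  using spread_transition_le[of k window]
    spread_contraction[of "transition k window" "a ^ window" "v k"]
    transition_window_ge transition_rows power_window by fastforce

text \<open>The induction jumps back by a whole window. Before the first full window there are too
  few perturbations to exceed the bound; afterwards the choice of \<open>mixing\<close> makes the
  bound reproduce itself.\<close>

lemma spread_bounded:
  assumes U: "\<And>t. b t \<le> U"
  shows "spread (v t) \<le> spread (v 0) + 2 * mixing * U"
proof (induction t rule: less_induct)
  case (less t)
  have U0: "0 \<le> U" by (rule order_trans[OF b_nonneg U])
  have sum_le: "(\<Sum>l<s. b (k + l)) \<le> real s * U" for k s
    using sum_bounded_above[of "{..<s}" "\<lambda>l. b (k + l)" U] U by simp
  show ?case
  proof (cases "t < window")
    case True
    have "spread (v t) \<le> spread (v 0) + 2 * (real t * U)"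
      using spread_step[of 0 t] sum_le[of 0 t] by simp
    moreover have "real t * U \<le> mixing * U"
      using True window_le_mixing U0 by (intro mult_right_mono) auto
    ultimately show ?thesis by simp
  next
    case False
    define k where "k = t - window"
    have t: "t = k + window" and "k < t" using False window_pos by (auto simp: k_def)
    let ?M = "spread (v 0) + 2 * mixing * U"
    have "spread (v t) \<le> (1 - a ^ window) * spread (v k) + 2 * (real window * U)"
      using spread_window_step[of k] sum_le[of k window] unfolding t by linarith
    also have "(1 - a ^ window) * spread (v k) \<le> (1 - a ^ window) * ?M"
      using less.IH[OF \<open>k < t\<close>] power_window by (intro mult_left_mono) auto
    also have "(1 - a ^ window) * ?M + 2 * (real window * U) = ?M - a ^ window * spread (v 0)"
      unfolding mixing_mult[symmetric] by (simp add: algebra_simps)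
    also have "\<dots> \<le> ?M" using power_window spread_nonneg[of "v 0"] by simp
    finally show ?thesis by simp
  qed
qed

text \<open>Double counting: each round lies in at most \<open>window\<close> of the
  windows.\<close>

lemma sum_window_le:
  assumes "window \<le> Suc T"
  shows "(\<Sum>k<Suc T - window. \<Sum>l<window. b (k + l)) \<le> real window * (\<Sum>t<T. b t)"
proof -
  have "(\<Sum>k<Suc T - window. \<Sum>l<window. b (k + l)) = (\<Sum>l<window. \<Sum>k<Suc T - window. b (k + l))"
    by (rule sum.swap)
  also have "\<dots> \<le> (\<Sum>l<window. \<Sum>t<T. b t)"
  proof (rule sum_mono)
    fix l assume l: "l \<in> {..<window}"
    have "(\<Sum>k<Suc T - window. b (k + l)) = (\<Sum>t\<in>(\<lambda>k. k + l) ` {..<Suc T - window}. b t)"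
      by (subst sum.reindex) auto
    also have "\<dots> \<le> (\<Sum>t<T. b t)"
      using l by (intro sum_mono2) (auto simp: b_nonneg)
    finally show "(\<Sum>k<Suc T - window. b (k + l)) \<le> (\<Sum>t<T. b t)" .
  qed
  finally show ?thesis by simp
qed

text \<open>Summing the contraction over all windows bounds the sum by \<open>1 - a ^ window\<close> times itself plus
  the perturbations, so no geometric series is needed.\<close>
lemma sum_spread_le:
  "(\<Sum>t\<le>T. spread (v t)) \<le> mixing * (spread (v 0) + 4 * (\<Sum>t<T. b t))"
proof -
  let ?S = "\<Sum>t<Suc T. spread (v t)" and ?\<beta> = "\<Sum>t<T. b t"
  have early: "spread (v t) \<le> spread (v 0) + 2 * ?\<beta>" if "t \<le> T" for t
  proof -
    have "(\<Sum>l<t. b l) \<le> ?\<beta>" using that by (intro sum_mono2) (auto simp: b_nonneg)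
    then show ?thesis using spread_step[of 0 t] by simp
  qed
  have \<beta>: "0 \<le> ?\<beta>" by (intro sum_nonneg b_nonneg)
  \<comment> \<open>Of the four copies of the perturbations, two pay for the first
    \<open>window\<close> rounds, where no contraction is available, and two for the later windows.
    A horizon shorter than a window needs only the first kind.\<close>
  have "?S \<le> (1 - a ^ window) * ?S + real window * (spread (v 0) + 4 * ?\<beta>)"
  proof (cases "window \<le> Suc T")
    case True
    have "?S = (\<Sum>t<window. spread (v t)) + (\<Sum>k<Suc T - window. spread (v (k + window)))"
    proof -
      have "?S = (\<Sum>t<window. spread (v t)) + (\<Sum>t\<in>{window..<Suc T}. spread (v t))"
        using True sum.atLeastLessThan_concat[of 0 window "Suc T" "\<lambda>t. spread (v t)"]
        by (simp add: atLeast0LessThan)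
      also have "(\<Sum>t\<in>{window..<Suc T}. spread (v t)) = (\<Sum>k<Suc T - window. spread (v (k + window)))"
        using True sum.shift_bounds_nat_ivl[of "\<lambda>t. spread (v t)" 0 window "Suc T - window"]
        by (simp add: atLeast0LessThan)
      finally show ?thesis .
    qed
    also have "(\<Sum>t<window. spread (v t)) \<le> real window * (spread (v 0) + 2 * ?\<beta>)"
      using sum_bounded_above[of "{..<window}" "\<lambda>t. spread (v t)"] early True by fastforce
    also have "(\<Sum>k<Suc T - window. spread (v (k + window)))
        \<le> (\<Sum>k<Suc T - window. (1 - a ^ window) * spread (v k) + 2 * (\<Sum>l<window. b (k + l)))"
      by (intro sum_mono spread_window_step)
    also have "\<dots> = (1 - a ^ window) * (\<Sum>k<Suc T - window. spread (v k))
        + 2 * (\<Sum>k<Suc T - window. \<Sum>l<window. b (k + l))"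
      by (simp only: sum.distrib sum_distrib_left)
    also have "(1 - a ^ window) * (\<Sum>k<Suc T - window. spread (v k)) \<le> (1 - a ^ window) * ?S"
      using power_window by (intro mult_left_mono sum_mono2) (auto simp: spread_nonneg)
    finally show ?thesis using sum_window_le[OF True] by (simp add: algebra_simps)
  next
    case False
    have "?S \<le> real (Suc T) * (spread (v 0) + 2 * ?\<beta>)"
      using sum_bounded_above[of "{..<Suc T}" "\<lambda>t. spread (v t)"] early by fastforce
    also have "\<dots> \<le> real window * (spread (v 0) + 4 * ?\<beta>)"
      using False \<beta> spread_nonneg[of "v 0"] by (intro mult_mono) auto
    also have "\<dots> \<le> (1 - a ^ window) * ?S + \<dots>"
      using power_window by (simp add: sum_nonneg spread_nonneg)
    finally show ?thesis .
  qed
  then have "a ^ window * ?S \<le> real window * (spread (v 0) + 4 * ?\<beta>)"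
    by (simp add: algebra_simps)
  then have "?S \<le> mixing * (spread (v 0) + 4 * ?\<beta>)"
    using power_window by (simp add: mixing_def field_simps)
  then show ?thesis by (simp add: lessThan_Suc_atMost)
qed

end

section \<open>Gradients and projected steps\<close>

text \<open>Restriction to the line through \<open>x\<close> and \<open>y\<close> reduces the
  first-order condition to the scalar one, between the parameters 0 and 1.\<close>

lemma convex_on_UNIV_above_tangent:
  fixes g :: "'a::real_normed_vector \<Rightarrow> real"
  assumes conv: "convex_on UNIV g" and deriv: "(g has_derivative g') (at x)"
  shows "g x - g y \<le> g' (x - y)"
proof -
  let ?l = "\<lambda>s::real. x + s *\<^sub>R (y - x)"
  interpret g': linear g' using deriv by (rule has_derivative_linear)
  have "convex_on UNIV (\<lambda>s. g (?l s))"
  proof (rule convex_onI)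
    fix t r s :: real assume t: "0 < t" "t < 1"
    have "?l ((1 - t) *\<^sub>R r + t *\<^sub>R s) = (1 - t) *\<^sub>R ?l r + t *\<^sub>R ?l s"
      by (simp add: algebra_simps)
    then show "g (?l ((1 - t) *\<^sub>R r + t *\<^sub>R s)) \<le> (1 - t) * g (?l r) + t * g (?l s)"
      using convex_onD[OF conv, of t "?l r" "?l s"] t by simp
  qed simp
  moreover have "((\<lambda>s. g (?l s)) has_field_derivative g' (y - x)) (at 0)"
  proof -
    have "(?l has_derivative (\<lambda>s. s *\<^sub>R (y - x))) (at 0)"
      by (auto intro!: derivative_eq_intros)
    moreover have "(g has_derivative g') (at (?l 0))" using deriv by simp
    ultimately have "((\<lambda>s. g (?l s)) has_derivative (\<lambda>s. g' (s *\<^sub>R (y - x)))) (at 0)"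
      by (rule has_derivative_compose)
    then show ?thesis
      by (simp add: has_field_derivative_def g'.scaleR mult.commute[of _ "g' _"] fun_eq_iff)
  qed
  ultimately have "g' (y - x) * (1 - 0) \<le> g (?l 1) - g (?l 0)"
    by (intro convex_on_imp_above_tangent) auto
  then show ?thesis by (simp add: g'.diff)
qed

text \<open>Composing the joint derivative with the embeddings of the two factors identifies its two
  parts with the partial gradients, by uniqueness of derivatives; linearity adds the parts.\<close>

lemma partial_gradients:
  fixes g :: "'a::euclidean_space \<Rightarrow> 'b::euclidean_space \<Rightarrow> real"
  assumes "(\<lambda>(u, z). g u z) differentiable (at (u, z))"
  shows "(\<lambda>u'. g u' z) differentiable (at u)"
    and "((\<lambda>p. g (fst p) (snd p)) has_derivative
      (\<lambda>h. fst h \<bullet> grad1 g u z + snd h \<bullet> grad2 g u z)) (at (u, z))"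
proof -
  obtain F' where F': "((\<lambda>p. g (fst p) (snd p)) has_derivative F') (at (u, z))"
    using assms by (auto simp: differentiable_def case_prod_beta')
  interpret F': linear F' using F' by (rule has_derivative_linear)
  have "((\<lambda>u'. (u', z)) has_derivative (\<lambda>h. (h, 0))) (at u)"
    by (auto intro!: derivative_eq_intros)
  from has_derivative_compose[OF this F'] have D1: "((\<lambda>u'. g u' z) has_derivative (\<lambda>h. F' (h, 0))) (at u)"
    by simp
  then show "(\<lambda>u'. g u' z) differentiable (at u)" by (rule differentiableI)
  from gradient_works[OF this] have "(\<lambda>h. F' (h, 0)) = (\<lambda>h. h \<bullet> grad1 g u z)"
    unfolding gderiv_def grad1_def by (rule has_derivative_unique[OF D1])
  then have F1: "F' (h, 0) = h \<bullet> grad1 g u z" for h by meson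
  have "((\<lambda>z'. (u, z')) has_derivative (\<lambda>h. (0, h))) (at z)"
    by (auto intro!: derivative_eq_intros)
  from has_derivative_compose[OF this F'] have D2: "((\<lambda>z'. g u z') has_derivative (\<lambda>h. F' (0, h))) (at z)"
    by simp
  from gradient_works[OF differentiableI[OF this]] have "(\<lambda>h. F' (0, h)) = (\<lambda>h. h \<bullet> grad2 g u z)"
    unfolding gderiv_def grad2_def by (rule has_derivative_unique[OF D2])
  then have F2: "F' (0, h) = h \<bullet> grad2 g u z" for h by meson
  have "F' h = fst h \<bullet> grad1 g u z + snd h \<bullet> grad2 g u z" for h
    using F'.add[of "(fst h, 0)" "(0, snd h)"] by (simp add: F1 F2)
  then have "F' = (\<lambda>h. fst h \<bullet> grad1 g u z + snd h \<bullet> grad2 g u z)" by blast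
  then show "((\<lambda>p. g (fst p) (snd p)) has_derivative
      (\<lambda>h. fst h \<bullet> grad1 g u z + snd h \<bullet> grad2 g u z)) (at (u, z))"
    using F' by simp
qed

section \<open>Blocks and transposed Jacobians\<close>

lemma linear_block: "linear (block own i)"
  by (rule linearI) (auto simp: block_def vec_eq_iff)

lemma block_diff: "block own i (x - y) = block own i x - block own i y"
  using linear_block by (rule linear_diff)

lemma norm_block_le: "norm (block own i x) \<le> norm x"
  by (rule norm_le_componentwise_cart) (simp add: block_def)

lemma block_col: "(\<And>j. u j \<in> block_space own j) \<Longrightarrow> block own i (col own u) = u i"
  by (auto simp: block_def block_space_def col_def vec_eq_iff)

lemma inner_nabla: "(jacobian g (at u) *v h) \<bullet> s = h \<bullet> (nabla g u *v s)"
  using dot_lmul_matrix[of s "jacobian g (at u)" h] by (simp add: nabla_def inner_commute)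

lemma norm_matrix_vector_le:
  fixes M :: "real^'d^'n"
  assumes "matrix_norm M \<le> c"
  shows "norm (M *v z) \<le> c * norm z"
  using onorm[OF matrix_vector_mul_bounded_linear, of M z] mult_right_mono[OF assms norm_ge_zero[of z]]
  by linarith

text \<open>A matrix and its transpose have the same operator norm: for the image \<open>w\<close>
  of \<open>h\<close>, adjointness and Cauchy-Schwarz give
  \<open>norm w * norm w \<le> c * norm h * norm w\<close>, and a nonzero \<open>norm w\<close>
  cancels.\<close>

lemma norm_jacobian_le:
  assumes "matrix_norm (nabla g u) \<le> c"
  shows "norm (jacobian g (at u) *v h) \<le> c * norm h"
proof -
  let ?w = "jacobian g (at u) *v h"
  have "norm ?w * norm ?w = h \<bullet> (nabla g u *v ?w)"
    unfolding inner_nabla[symmetric] by (simp add: power2_norm_eq_inner flip: power2_eq_square)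
  also have "\<dots> \<le> norm h * norm (nabla g u *v ?w)" by (rule norm_cauchy_schwarz)
  also have "\<dots> \<le> norm h * (c * norm ?w)"
    by (intro mult_left_mono norm_matrix_vector_le assms) auto
  finally have le: "norm ?w * norm ?w \<le> (c * norm h) * norm ?w" by (simp add: mult_ac)
  show ?thesis
  proof (cases "norm ?w = 0")
    case True
    have "0 \<le> c" using assms onorm_pos_le[of "\<lambda>v. nabla g u *v v"] by (simp add: matrix_vector_mul_bounded_linear)
    then show ?thesis using True by simp
  next
    case False
    then show ?thesis using le by simp
  qed
qed

section \<open>Projected gradient steps\<close>

lemma norm_closest_point_step_le:
  fixes S :: "'a::euclidean_space set"
  assumes "convex S" "closed S" "z \<in> S"
  shows "norm (closest_point S w - z) \<le> norm (w - z)"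
  using closest_point_lipschitz[of S w z] assms
  by (auto simp: closest_point_self dist_norm)

text \<open>Projection does not increase the distance to the feasible point \<open>z\<close>;
  expanding the squared distance after the unprojected step isolates the inner product.\<close>

lemma projected_step_inner_le:
  fixes S :: "'a::euclidean_space set"
  assumes "convex S" "closed S" "z \<in> S" and \<alpha>: "0 < \<alpha>" and g: "norm g \<le> K"
  shows "g \<bullet> (u - z) \<le> ((norm (u - z))\<^sup>2 - (norm (closest_point S (u - \<alpha> *\<^sub>R g) - z))\<^sup>2) / (2 * \<alpha>)
    + \<alpha> * K\<^sup>2 / 2"
proof -
  have "(norm (closest_point S (u - \<alpha> *\<^sub>R g) - z))\<^sup>2 \<le> (norm (u - \<alpha> *\<^sub>R g - z))\<^sup>2"
    by (intro power_mono norm_closest_point_step_le assms) auto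
  also have "\<dots> = (norm (u - z))\<^sup>2 - 2 * \<alpha> * (g \<bullet> (u - z)) + \<alpha>\<^sup>2 * (norm g)\<^sup>2"
    unfolding power2_norm_eq_inner
    by (simp add: inner_diff_left inner_diff_right inner_commute algebra_simps power2_eq_square)
  also have "\<dots> \<le> (norm (u - z))\<^sup>2 - 2 * \<alpha> * (g \<bullet> (u - z)) + \<alpha>\<^sup>2 * K\<^sup>2"
    using g by (simp add: mult_left_mono power_mono)
  finally have "2 * \<alpha> * (g \<bullet> (u - z)) \<le> (norm (u - z))\<^sup>2
      - (norm (closest_point S (u - \<alpha> *\<^sub>R g) - z))\<^sup>2 + \<alpha>\<^sup>2 * K\<^sup>2" by simp
  then have "g \<bullet> (u - z) \<le> ((norm (u - z))\<^sup>2
      - (norm (closest_point S (u - \<alpha> *\<^sub>R g) - z))\<^sup>2 + \<alpha>\<^sup>2 * K\<^sup>2) / (2 * \<alpha>)"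
    using \<alpha> by (simp add: pos_le_divide_eq mult.commute)
  also have "\<dots> = ((norm (u - z))\<^sup>2 - (norm (closest_point S (u - \<alpha> *\<^sub>R g) - z))\<^sup>2) / (2 * \<alpha>)
    + \<alpha> * K\<^sup>2 / 2"
    using \<alpha> by (simp add: add_divide_distrib power2_eq_square)
  finally show ?thesis .
qed

text \<open>Factoring the difference of squares prices the replacement of one comparator by the next
  in a telescoping sum.\<close>

lemma power2_norm_diff_le:
  assumes "norm p \<le> c" "norm q \<le> c"
  shows "(norm p)\<^sup>2 - (norm q)\<^sup>2 \<le> 2 * c * norm (p - q)"
proof -
  have "(norm p)\<^sup>2 - (norm q)\<^sup>2 = (norm p + norm q) * (norm p - norm q)"
    by (simp add: power2_eq_square algebra_simps)
  also have "\<dots> \<le> (norm p + norm q) * norm (p - q)"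
    by (intro mult_left_mono norm_triangle_ineq2) auto
  also have "\<dots> \<le> (2 * c) * norm (p - q)"
    using assms by (intro mult_right_mono) auto
  finally show ?thesis by simp
qed

section \<open>The online aggregative problem\<close>

text \<open>Here \<open>L\<close> stands for a nonnegative Lipschitz constant, so that monotonicity
  arguments apply directly; the theorem instantiates it by an absolute value.\<close>

locale odgt_problem = consensus_weights A E Q a
  for A :: "nat \<Rightarrow> real^'v::finite^'v" and E Q a +
  fixes own :: "'n::finite \<Rightarrow> 'v"
    and X :: "'v \<Rightarrow> (real^'n) set"
    and \<psi> :: "'v \<Rightarrow> real^'n \<Rightarrow> real^'d::finite"
    and f :: "'v \<Rightarrow> nat \<Rightarrow> real^'n \<Rightarrow> real^'d \<Rightarrow> real"
    and xstar :: "nat \<Rightarrow> real^'n"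
    and B L G :: real
  assumes X_space: "\<And>i. X i \<subseteq> block_space own i"
    and psi_diff: "\<And>i. \<psi> i differentiable_on UNIV"
    and f_block: "\<And>i t z. depends_on_block own i (\<lambda>u. f i t u z)"
    and f_diff: "\<And>i t. (\<lambda>(u, z). f i t u z) differentiable_on UNIV"
    and xstar: "\<And>t. is_arg_min (total_loss own \<psi> f t) (\<lambda>x. x \<in> joint_set own X) (xstar t)"
    and X_set: "\<And>i. X i \<noteq> {} \<and> convex (X i) \<and> compact (X i)"
    and B: "B > 0" "\<And>i u. u \<in> X i \<Longrightarrow> norm u \<le> B"
    and f_convex: "\<And>t. convex_on UNIV (total_loss own \<psi> f t)"
    and L: "L \<ge> 0"
    and lipschitz1: "\<And>t x x' y y'. x \<in> joint_set own X \<Longrightarrow> x' \<in> joint_set own X \<Longrightarrow>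
      norm (stacked_grad1 own f t x y - stacked_grad1 own f t x' y')
        \<le> L * (norm (x - x') + norm (y - y'))"
    and lipschitz2: "\<And>t x x' y y'. x \<in> joint_set own X \<Longrightarrow> x' \<in> joint_set own X \<Longrightarrow>
      norm (stacked_grad2 own f t x y - stacked_grad2 own f t x' y')
        \<le> L * (norm (x - x') + norm (y - y'))"
    and G: "G > 0"
      "\<And>t x y. x \<in> joint_set own X \<Longrightarrow> norm (stacked_grad1 own f t x y) \<le> G"
      "\<And>t x y. x \<in> joint_set own X \<Longrightarrow> norm (stacked_grad2 own f t x y) \<le> G"
      "\<And>i x. x \<in> joint_set own X \<Longrightarrow> matrix_norm (nabla (\<psi> i) (block own i x)) \<le> G"
begin

section \<open>Bounds for single agents from bounds for stacked vectors\<close>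

definition anchor :: "'v \<Rightarrow> real^'n" where "anchor j = (SOME w. w \<in> X j)"

text \<open>The assumptions concern feasible stacked points. Fixed feasible points for the other
  agents complete \<open>u\<close> to such a point, and two completions differ only in block
  \<open>i\<close>, so distances are preserved.\<close>

definition extend :: "'v \<Rightarrow> real^'n \<Rightarrow> real^'n" where
  "extend i u = col own (\<lambda>j. if j = i then u else anchor j)"

lemma anchor_in: "anchor j \<in> X j"
  using X_set[of j] by (auto simp: anchor_def intro: someI)

lemma block_col_X: "(\<And>j. u j \<in> X j) \<Longrightarrow> block own i (col own u) = u i"
  using X_space by (blast intro: block_col)

lemma col_in_joint_set: "(\<And>j. u j \<in> X j) \<Longrightarrow> col own u \<in> joint_set own X"
  by (simp add: joint_set_def block_col_X)

lemma extend_in_joint_set: "u \<in> X i \<Longrightarrow> extend i u \<in> joint_set own X"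
  unfolding extend_def by (rule col_in_joint_set) (simp add: anchor_in)

lemma block_extend: "u \<in> X i \<Longrightarrow> block own i (extend i u) = u"
  unfolding extend_def by (subst block_col_X) (auto simp: anchor_in)

lemma extend_diff: "u \<in> X i \<Longrightarrow> u' \<in> X i \<Longrightarrow> extend i u - extend i u' = u - u'"
  using subsetD[OF X_space, of u i] subsetD[OF X_space, of u' i]
  by (auto simp: extend_def col_def block_space_def vec_eq_iff)

lemma f_differentiable: "(\<lambda>(u, z). f i t u z) differentiable (at (u, z))"
  using f_diff by (simp add: differentiable_on_def)

lemma grad1_in_block_space: "grad1 (f i t) u z \<in> block_space own i"
  unfolding grad1_def by (rule gradient_in_block_space[OF f_block partial_gradients(1)[OF f_differentiable]])

lemma grad1_eq_block_stacked: "grad1 (f i t) (block own i x) (y $ i) = block own i (stacked_grad1 own f t x y)"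
  unfolding stacked_grad1_def by (subst block_col) (auto simp: grad1_in_block_space)

text \<open>The stacked bound is applied to the completion of \<open>u\<close> and to
  \<open>axis i z\<close>, which is zero at the other agents; a block is no longer than the whole
  vector.\<close>

lemma norm_grad1_le:
  assumes "u \<in> X i"
  shows "norm (grad1 (f i t) u z) \<le> G"
  using grad1_eq_block_stacked[of i t "extend i u" "axis i z"] assms
    norm_block_le[of own i "stacked_grad1 own f t (extend i u) (axis i z)"]
    G(2)[OF extend_in_joint_set[OF assms], of t "axis i z"]
  by (simp add: block_extend)

lemma norm_grad2_le:
  assumes "u \<in> X i"
  shows "norm (grad2 (f i t) u z) \<le> G"
  using Finite_Cartesian_Product.norm_nth_le[of "stacked_grad2 own f t (extend i u) (axis i z)" i]
    G(3)[OF extend_in_joint_set[OF assms], of t "axis i z"] assms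
  by (simp add: block_extend stacked_grad2_def)

lemma norm_axis_diff: "norm (axis i z - axis i z' :: real^'d^'v) = norm (z - z')"
proof -
  have "axis i z - axis i z' = (axis i (z - z') :: real^'d^'v)" by (auto simp: axis_def vec_eq_iff)
  then show ?thesis by (simp add: norm_eq_sqrt_inner inner_axis_axis)
qed

lemma grad1_lipschitz:
  assumes "u \<in> X i" "u' \<in> X i"
  shows "norm (grad1 (f i t) u z - grad1 (f i t) u' z') \<le> L * (norm (u - u') + norm (z - z'))"
proof -
  let ?s = "\<lambda>u z. stacked_grad1 own f t (extend i u) (axis i z)"
  have "grad1 (f i t) u z - grad1 (f i t) u' z' = block own i (?s u z - ?s u' z')"
    using grad1_eq_block_stacked[of i t "extend i u" "axis i z"] assms
      grad1_eq_block_stacked[of i t "extend i u'" "axis i z'"] by (simp add: block_extend block_diff)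
  then have "norm (grad1 (f i t) u z - grad1 (f i t) u' z') \<le> norm (?s u z - ?s u' z')"
    by (simp add: norm_block_le)
  also have "\<dots> \<le> L * (norm (u - u') + norm (z - z'))"
    using lipschitz1[of "extend i u" "extend i u'" t "axis i z" "axis i z'"] assms
    by (simp add: extend_in_joint_set extend_diff norm_axis_diff)
  finally show ?thesis .
qed

lemma grad2_lipschitz:
  assumes "u \<in> X i" "u' \<in> X i"
  shows "norm (grad2 (f i t) u z - grad2 (f i t) u' z') \<le> L * (norm (u - u') + norm (z - z'))"
proof -
  let ?s = "\<lambda>u z. stacked_grad2 own f t (extend i u) (axis i z)"
  have "grad2 (f i t) u z - grad2 (f i t) u' z' = (?s u z - ?s u' z') $ i"
    using assms by (simp add: stacked_grad2_def block_extend)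
  then have "norm (grad2 (f i t) u z - grad2 (f i t) u' z') \<le> norm (?s u z - ?s u' z')"
    using Finite_Cartesian_Product.norm_nth_le[of "?s u z - ?s u' z'" i] by simp
  also have "\<dots> \<le> L * (norm (u - u') + norm (z - z'))"
    using lipschitz2[of "extend i u" "extend i u'" t "axis i z" "axis i z'"] assms
    by (simp add: extend_in_joint_set extend_diff norm_axis_diff)
  finally show ?thesis .
qed

lemma matrix_norm_nabla_le: "u \<in> X i \<Longrightarrow> matrix_norm (nabla (\<psi> i) u) \<le> G"
  using G(4)[OF extend_in_joint_set, of u i i] by (simp add: block_extend)

lemma psi_has_derivative: "(\<psi> i has_derivative (\<lambda>h. jacobian (\<psi> i) (at u) *v h)) (at u)"
  using psi_diff[of i] by (simp add: differentiable_on_def flip: jacobian_works)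

text \<open>This is the mean value inequality on the convex set \<open>X i\<close>, with the bound
  on \<open>nabla\<close> transferred to the Jacobian.\<close>

lemma psi_lipschitz:
  assumes "u \<in> X i" "u' \<in> X i"
  shows "norm (\<psi> i u - \<psi> i u') \<le> G * norm (u - u')"
proof (rule differentiable_bound[of "X i"])
  show "convex (X i)" using X_set by blast
  show "(\<psi> i has_derivative (\<lambda>h. jacobian (\<psi> i) (at w) *v h)) (at w within X i)" for w
    by (rule has_derivative_at_withinI[OF psi_has_derivative])
  show "onorm (\<lambda>h. jacobian (\<psi> i) (at w) *v h) \<le> G" if "w \<in> X i" for w
    by (rule onorm_le) (rule norm_jacobian_le[OF matrix_norm_nabla_le[OF that]])
qed (use assms in auto)

lemma norm_grad2_diff_le: "u \<in> X i \<Longrightarrow> norm (grad2 (f i s) u z - grad2 (f i t) u z) \<le> 2 * G"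
  using norm_grad2_le[of u i s z] norm_grad2_le[of u i t z]
    norm_triangle_ineq4[of "grad2 (f i s) u z" "grad2 (f i t) u z"] by simp

lemma norm_grad2_diff_le_grad_drift:
  assumes "u \<in> X i"
  shows "norm (grad2 (f i (Suc t)) u z - grad2 (f i t) u z) \<le> grad_drift X f t"
proof -
  let ?d = "\<lambda>i (u, z). norm (grad2 (f i (t + 1)) u z - grad2 (f i t) u z)"
  \<comment> \<open>A real supremum dominates its members only over a bounded set; the gradient
    bound supplies \<open>2 * G\<close>.\<close>
  have bdd: "bdd_above (?d i ` (X i \<times> UNIV))" for i
    by (rule bdd_aboveI[where M = "2 * G"]) (auto intro: norm_grad2_diff_le)
  have upper: "?d i (u, z) \<le> (SUP p\<in>X i \<times> UNIV. ?d i p)" if "u \<in> X i" for i u z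
    by (rule cSUP_upper[OF _ bdd]) (use that in auto)
  \<comment> \<open>Nonnegativity of the other agents' suprema, seen at their anchors, allows one
    summand to be compared with the whole sum.\<close>
  have "0 \<le> (SUP p\<in>X j \<times> UNIV. ?d j p)" for j
  proof -
    have "0 \<le> ?d j (anchor j, undefined)" by simp
    also have "\<dots> \<le> (SUP p\<in>X j \<times> UNIV. ?d j p)" by (rule upper[OF anchor_in])
    finally show ?thesis .
  qed
  then have "(SUP p\<in>X i \<times> UNIV. ?d i p) \<le> grad_drift X f t"
    unfolding grad_drift_def by (intro member_le_sum) auto
  then show ?thesis using upper[OF assms, of z] by simp
qed

lemma grad_drift_nonneg: "0 \<le> grad_drift X f t"
  by (rule order_trans[OF norm_ge_zero norm_grad2_diff_le_grad_drift[OF anchor_in]])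

lemma grad_drift_le: "grad_drift X f t \<le> 2 * G * real CARD('v)"
proof -
  have "grad_drift X f t \<le> (\<Sum>i\<in>(UNIV::'v set). 2 * G)"
    unfolding grad_drift_def
    by (intro sum_mono cSUP_least) (use X_set in \<open>auto intro: norm_grad2_diff_le\<close>)
  then show ?thesis by (simp add: mult.commute)
qed

section \<open>The gradient of the total loss\<close>

definition loss_gradient :: "nat \<Rightarrow> real^'n \<Rightarrow> 'v \<Rightarrow> real^'n" where
  "loss_gradient t x i = grad1 (f i t) (block own i x) (aggregate own \<psi> x)
     + nabla (\<psi> i) (block own i x) *v
         ((1 / real CARD('v)) *\<^sub>R (\<Sum>j\<in>UNIV. grad2 (f j t) (block own j x) (aggregate own \<psi> x)))"

lemma block_has_derivative: "(block own i has_derivative block own i) (at x)"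
  by (rule linear_imp_has_derivative) (rule linear_block)

lemma aggregate_has_derivative:
  "(aggregate own \<psi> has_derivative
     (\<lambda>h. (1 / real CARD('v)) *\<^sub>R (\<Sum>i\<in>UNIV. jacobian (\<psi> i) (at (block own i x)) *v block own i h))) (at x)"
  unfolding aggregate_def[abs_def]
  by (intro has_derivative_scaleR_right has_derivative_sum
      has_derivative_compose[OF block_has_derivative psi_has_derivative])

text \<open>By the chain rule through the pair of own block and aggregate, agent \<open>i\<close>
  influences every loss. This is why \<open>loss_gradient\<close> contains the mean of all second
  gradients.\<close>

lemma total_loss_has_derivative:
  "(total_loss own \<psi> f t has_derivative (\<lambda>h. \<Sum>i\<in>UNIV. block own i h \<bullet> loss_gradient t x i)) (at x)"
proof -
  let ?a = "aggregate own \<psi> x"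
  let ?a' = "\<lambda>h. (1 / real CARD('v)) *\<^sub>R (\<Sum>i\<in>UNIV. jacobian (\<psi> i) (at (block own i x)) *v block own i h)"
  let ?g1 = "\<lambda>i. grad1 (f i t) (block own i x) ?a" and ?g2 = "\<lambda>i. grad2 (f i t) (block own i x) ?a"
  have "((\<lambda>x. f i t (fst (block own i x, aggregate own \<psi> x)) (snd (block own i x, aggregate own \<psi> x)))
      has_derivative (\<lambda>h. fst (block own i h, ?a' h) \<bullet> ?g1 i + snd (block own i h, ?a' h) \<bullet> ?g2 i)) (at x)" for i
    by (rule has_derivative_compose[OF has_derivative_Pair[OF block_has_derivative aggregate_has_derivative]
          partial_gradients(2)[OF f_differentiable]])
  then have "((\<lambda>x. f i t (block own i x) (aggregate own \<psi> x)) has_derivative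
      (\<lambda>h. block own i h \<bullet> ?g1 i + ?a' h \<bullet> ?g2 i)) (at x)" for i
    by (simp only: fst_conv snd_conv)
  then have "((\<lambda>x. \<Sum>i\<in>UNIV. f i t (block own i x) (aggregate own \<psi> x)) has_derivative
      (\<lambda>h. \<Sum>i\<in>UNIV. block own i h \<bullet> ?g1 i + ?a' h \<bullet> ?g2 i)) (at x)"
    by (rule has_derivative_sum)
  moreover have "(\<Sum>i\<in>UNIV. block own i h \<bullet> ?g1 i + ?a' h \<bullet> ?g2 i)
      = (\<Sum>i\<in>UNIV. block own i h \<bullet> loss_gradient t x i)" for h
  proof -
    let ?s = "(1 / real CARD('v)) *\<^sub>R (\<Sum>i\<in>UNIV. ?g2 i)"
    \<comment> \<open>The factor \<open>1 / N\<close> moves to the second gradients, giving their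
      mean \<open>?s\<close>; each Jacobian then passes to \<open>?s\<close> as its
      transpose.\<close>
    have "(\<Sum>i\<in>UNIV. ?a' h \<bullet> ?g2 i) = (\<Sum>i\<in>UNIV. jacobian (\<psi> i) (at (block own i x)) *v block own i h) \<bullet> ?s"
      by (simp add: inner_sum_right sum_divide_distrib)
    also have "\<dots> = (\<Sum>i\<in>UNIV. block own i h \<bullet> (nabla (\<psi> i) (block own i x) *v ?s))"
      unfolding inner_sum_left inner_nabla ..
    finally show ?thesis
      by (simp only: loss_gradient_def sum.distrib inner_add_right)
  qed
  ultimately show ?thesis unfolding total_loss_def[abs_def] by simp
qed

lemma total_loss_diff_le:
  "total_loss own \<psi> f t x - total_loss own \<psi> f t z
    \<le> (\<Sum>i\<in>UNIV. loss_gradient t x i \<bullet> (block own i x - block own i z))"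
  using convex_on_UNIV_above_tangent[OF f_convex total_loss_has_derivative, of t x z]
  by (simp add: block_diff inner_commute)

lemma block_xstar: "block own i (xstar t) \<in> X i"
  using xstar[of t] by (simp add: is_arg_min_def joint_set_def)

lemma total_loss_xstar_le: "x \<in> joint_set own X \<Longrightarrow> total_loss own \<psi> f t (xstar t) \<le> total_loss own \<psi> f t x"
  using xstar[of t] by (auto simp: is_arg_min_def not_less)

end

section \<open>Constants that depend neither on the run nor on the horizon\<close>

context odgt_problem
begin

text \<open>One \<open>G\<close> bounds the mean of the \<open>y\<close>; the rest bounds their
  spread, namely \<open>2 * G\<close> initially plus \<open>2 * mixing\<close> times the
  perturbation bound \<open>2 * G\<close>.\<close>

definition y_bound :: real where "y_bound = 3 * G + 4 * mixing * G"
definition direction_bound :: real where "direction_bound = G + G * y_bound"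
text \<open>The initial points are arbitrary, so they are compared with the fixed anchors: each
  value moves by at most \<open>2 * B * G\<close>, twice in a difference.\<close>

definition initial_spread_bound :: real where
  "initial_spread_bound = spread (\<lambda>i. \<psi> i (anchor i)) + 4 * B * G"

lemma direction_bound_nonneg: "0 \<le> direction_bound"
  using G(1) mixing_nonneg by (simp add: y_bound_def direction_bound_def)

lemma norm_diff_X_le: "u \<in> X i \<Longrightarrow> u' \<in> X i \<Longrightarrow> norm (u - u') \<le> 2 * B"
  using B(2)[of u i] B(2)[of u' i] norm_triangle_ineq4[of u u'] by simp

lemma initial_spread_le:
  assumes "\<And>i. u i \<in> X i"
  shows "spread (\<lambda>i. \<psi> i (u i)) \<le> initial_spread_bound"
proof -
  have "norm (\<psi> i (u i) - \<psi> i (anchor i)) \<le> G * (2 * B)" for i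
    using psi_lipschitz[OF assms anchor_in, of i] norm_diff_X_le[OF assms anchor_in, of i] G(1)
    by (meson mult_left_mono order_trans less_imp_le)
  from spread_le_add[of "\<lambda>i. \<psi> i (u i)", OF this] show ?thesis
    by (simp add: initial_spread_bound_def mult_ac)
qed

lemma path_variation_nonneg: "0 \<le> path_variation xstar T"
  by (simp add: path_variation_def sum_nonneg)

text \<open>The drift of each round is bounded, so the sum of squares grows at most linearly in
  \<open>T\<close>.\<close>

lemma grad_variation_sq_bounds:
  "0 \<le> grad_variation_sq X f T" "grad_variation_sq X f T \<le> (2 * G * real CARD('v))\<^sup>2 * real T"
proof -
  show "0 \<le> grad_variation_sq X f T" by (simp add: grad_variation_sq_def sum_nonneg)
  have "grad_variation_sq X f T \<le> (\<Sum>t=1..T. (2 * G * real CARD('v))\<^sup>2)"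
    unfolding grad_variation_sq_def by (intro sum_mono power_mono grad_drift_le grad_drift_nonneg)
  then show "grad_variation_sq X f T \<le> (2 * G * real CARD('v))\<^sup>2 * real T"
    by (simp add: mult.commute)
qed

text \<open>The tracking recursion starts in round 0 but the variation counts from round 1; the
  extra round costs a constant.\<close>

lemma sum_grad_drift_le: "(\<Sum>t<T. grad_drift X f t) \<le> 2 * G * real CARD('v) + grad_variation X f T"
proof -
  have "(\<Sum>t<T. grad_drift X f t) \<le> (\<Sum>t\<in>insert 0 {1..T}. grad_drift X f t)"
    by (intro sum_mono2) (auto simp: grad_drift_nonneg)
  then show ?thesis using grad_drift_le[of 0] by (simp add: grad_variation_def)
qed

end

section \<open>Runs of the algorithm\<close>

locale odgt_execution = odgt_problem A E Q a own X \<psi> f xstar B L G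
  for A :: "nat \<Rightarrow> real^'v::finite^'v" and E Q a
    and own :: "'n::finite \<Rightarrow> 'v" and X
    and \<psi> :: "'v \<Rightarrow> real^'n \<Rightarrow> real^'d::finite" and f xstar B L G +
  fixes \<alpha> :: real and x :: "nat \<Rightarrow> 'v \<Rightarrow> real^'n" and \<nu> y :: "nat \<Rightarrow> 'v \<Rightarrow> real^'d"
  assumes stepsize: "0 < \<alpha>" and run: "odgt_run X \<psi> f A (\<lambda>_. \<alpha>) x \<nu> y"
begin

definition direction :: "nat \<Rightarrow> 'v \<Rightarrow> real^'n" where
  "direction t i = grad1 (f i t) (x t i) (\<nu> t i) + nabla (\<psi> i) (x t i) *v y t i"

lemma start: "x 0 i \<in> X i" "\<nu> 0 i = \<psi> i (x 0 i)" "y 0 i = grad2 (f i 0) (x 0 i) (\<nu> 0 i)"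
  and x_Suc: "x (Suc t) i = closest_point (X i) (x t i - \<alpha> *\<^sub>R direction t i)"
  and nu_Suc: "\<nu> (Suc t) i = (\<Sum>j\<in>UNIV. A t $ i $ j *\<^sub>R \<nu> t j) + \<psi> i (x (Suc t) i) - \<psi> i (x t i)"
  and y_Suc: "y (Suc t) i = (\<Sum>j\<in>UNIV. A t $ i $ j *\<^sub>R y t j)
    + grad2 (f i (Suc t)) (x (Suc t) i) (\<nu> (Suc t) i) - grad2 (f i t) (x t i) (\<nu> t i)"
  using run unfolding odgt_run_def direction_def by auto

lemma X_closed: "closed (X i)" and X_convex: "convex (X i)" and X_nonempty: "X i \<noteq> {}"
  using X_set compact_imp_closed by auto

lemma x_in: "x t i \<in> X i"
  by (cases t) (simp_all add: start x_Suc closest_point_in_set X_closed X_nonempty)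

text \<open>Averaging conserves the total, and the added increments telescope from the matching
  initialization.\<close>

lemma sum_nu: "(\<Sum>i\<in>UNIV. \<nu> t i) = (\<Sum>i\<in>UNIV. \<psi> i (x t i))"
  by (induction t) (simp_all add: start nu_Suc sum.distrib sum_subtractf sum_average)

lemma sum_y: "(\<Sum>i\<in>UNIV. y t i) = (\<Sum>i\<in>UNIV. grad2 (f i t) (x t i) (\<nu> t i))"
  by (induction t) (simp_all add: start y_Suc sum.distrib sum_subtractf sum_average)

lemma spread_y_start: "spread (y 0) \<le> 2 * G"
proof (rule spread_leI)
  fix i j
  show "norm (y 0 i - y 0 j) \<le> 2 * G"
    using norm_grad2_le[OF x_in, of i 0 0 "\<nu> 0 i"] norm_grad2_le[OF x_in, of j 0 0 "\<nu> 0 j"]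
      norm_triangle_ineq4[of "y 0 i" "y 0 j"] by (simp add: start)
qed

text \<open>The mean of the \<open>y\<close> is a mean of second gradients, hence at most
  \<open>G\<close>, and perturbations of size \<open>2 * G\<close> keep the spread bounded. The
  bound is free of the stepsize.\<close>

lemma norm_y_le: "norm (y t i) \<le> y_bound"
proof -
  interpret y: perturbed_consensus A E Q a y "\<lambda>_. 2 * G"
  proof
    fix t i
    show "norm (y (Suc t) i - (\<Sum>j\<in>UNIV. A t $ i $ j *\<^sub>R y t j)) \<le> 2 * G"
      using norm_grad2_le[OF x_in, of i "Suc t" "Suc t" "\<nu> (Suc t) i"]
        norm_grad2_le[OF x_in, of i t t "\<nu> t i"]
        norm_triangle_ineq4[of "grad2 (f i (Suc t)) (x (Suc t) i) (\<nu> (Suc t) i)" "grad2 (f i t) (x t i) (\<nu> t i)"]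
      by (simp add: y_Suc)
  qed
  let ?m = "(1 / real CARD('v)) *\<^sub>R (\<Sum>j\<in>UNIV. y t j)"
  have "norm (0 - (\<Sum>j\<in>UNIV. (1 / real CARD('v)) *\<^sub>R grad2 (f j t) (x t j) (\<nu> t j))) \<le> G"
    by (rule norm_diff_weighted_sum_le) (auto simp: norm_grad2_le x_in)
  then have "norm ?m \<le> G" by (simp add: sum_y scaleR_sum_right)
  moreover have "norm (y t i - ?m) \<le> spread (y t)" by (rule norm_diff_mean_le_spread)
  moreover have "spread (y t) \<le> spread (y 0) + 2 * mixing * (2 * G)"
    by (rule y.spread_bounded) simp
  moreover have "norm (y t i) \<le> norm ?m + norm (y t i - ?m)"
    using norm_triangle_ineq[of ?m "y t i - ?m"] by simp
  ultimately show ?thesis using spread_y_start by (simp add: y_bound_def)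
qed

lemma norm_nabla_mult_le: "norm (nabla (\<psi> i) (x t i) *v w) \<le> G * norm w"
  by (rule norm_matrix_vector_le) (rule matrix_norm_nabla_le[OF x_in])

lemma norm_direction_le: "norm (direction t i) \<le> direction_bound"
proof -
  have "norm (nabla (\<psi> i) (x t i) *v y t i) \<le> G * y_bound"
    using norm_nabla_mult_le[of i t "y t i"] mult_left_mono[OF norm_y_le[of t i] less_imp_le[OF G(1)]]
    by linarith
  then show ?thesis
    using norm_grad1_le[OF x_in, of i t t "\<nu> t i"]
      norm_triangle_ineq[of "grad1 (f i t) (x t i) (\<nu> t i)" "nabla (\<psi> i) (x t i) *v y t i"]
    by (simp add: direction_def direction_bound_def)
qed

lemma norm_x_step_le: "norm (x (Suc t) i - x t i) \<le> \<alpha> * direction_bound"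
proof -
  have "norm (x (Suc t) i - x t i) \<le> norm (\<alpha> *\<^sub>R direction t i)"
    using norm_closest_point_step_le[OF X_convex X_closed x_in, of i "x t i - \<alpha> *\<^sub>R direction t i" t]
    by (simp add: x_Suc)
  also have "\<dots> \<le> \<alpha> * direction_bound"
    using stepsize norm_direction_le by (simp add: mult_left_mono)
  finally show ?thesis .
qed

lemma norm_psi_step_le: "norm (\<psi> i (x (Suc t) i) - \<psi> i (x t i)) \<le> G * (\<alpha> * direction_bound)"
  using psi_lipschitz[OF x_in[of "Suc t" i] x_in[of t i]]
    mult_left_mono[OF norm_x_step_le[of t i] less_imp_le[OF G(1)]]
  by linarith

text \<open>The averaging moves a value by at most the current spread, and the increment of
  \<open>\<psi>\<close> adds the rest.\<close>

lemma norm_nu_step_le: "norm (\<nu> (Suc t) i - \<nu> t i) \<le> spread (\<nu> t) + G * (\<alpha> * direction_bound)"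
proof -
  let ?m = "\<Sum>j\<in>UNIV. A t $ i $ j *\<^sub>R \<nu> t j"
  have "norm (\<nu> t i - ?m) \<le> spread (\<nu> t)"
    by (rule norm_diff_weighted_sum_le) (auto simp: A_nonneg A_rows norm_diff_le_spread)
  moreover have "norm (\<nu> (Suc t) i - \<nu> t i) = norm ((\<psi> i (x (Suc t) i) - \<psi> i (x t i)) - (\<nu> t i - ?m))"
    by (simp add: nu_Suc algebra_simps)
  ultimately show ?thesis
    using norm_psi_step_le[of i t]
      norm_triangle_ineq4[of "\<psi> i (x (Suc t) i) - \<psi> i (x t i)" "\<nu> t i - ?m"] by linarith
qed

lemma sum_spread_nu_le:
  "(\<Sum>t\<le>T. spread (\<nu> t))
    \<le> mixing * (initial_spread_bound + 4 * (real T * (G * (\<alpha> * direction_bound))))"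
proof -
  interpret nu: perturbed_consensus A E Q a \<nu> "\<lambda>_. G * (\<alpha> * direction_bound)"
  proof
    fix t i
    show "norm (\<nu> (Suc t) i - (\<Sum>j\<in>UNIV. A t $ i $ j *\<^sub>R \<nu> t j)) \<le> G * (\<alpha> * direction_bound)"
      using norm_psi_step_le[of i t] by (simp add: nu_Suc)
  qed
  have "spread (\<nu> 0) \<le> initial_spread_bound"
    using initial_spread_le[of "x 0", OF x_in] start(2) by (simp add: spread_def)
  then have "mixing * (spread (\<nu> 0) + 4 * (real T * (G * (\<alpha> * direction_bound))))
      \<le> mixing * (initial_spread_bound + 4 * (real T * (G * (\<alpha> * direction_bound))))"
    by (intro mult_left_mono mixing_nonneg) simp
  then show ?thesis using nu.sum_spread_le[of T] by simp
qed

text \<open>The perturbation of \<open>y\<close> splits into the change of loss at a fixed argument,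
  which is the drift, and the change of argument under a fixed loss, controlled by the Lipschitz
  constant. The latter involves the step of \<open>\<nu>\<close> and thus its spread.\<close>

lemma sum_spread_y_le:
  "(\<Sum>t\<le>T. spread (y t)) \<le> mixing * (2 * G + 4 * (2 * G * real CARD('v) + grad_variation X f T
    + L * (real T * (\<alpha> * direction_bound) + (\<Sum>t\<le>T. spread (\<nu> t))
        + real T * (G * (\<alpha> * direction_bound)))))"
proof -
  let ?K = "\<alpha> * direction_bound"
  let ?b = "\<lambda>t. grad_drift X f t + L * (?K + (spread (\<nu> t) + G * ?K))"
  interpret y: perturbed_consensus A E Q a y ?b
  proof
    fix t i
    let ?g = "\<lambda>t' t. grad2 (f i t') (x t i) (\<nu> t i)"
    have "norm (?g (Suc t) t - ?g t t) \<le> grad_drift X f t"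
      by (rule norm_grad2_diff_le_grad_drift) (rule x_in)
    moreover have "norm (?g (Suc t) (Suc t) - ?g (Suc t) t) \<le> L * (?K + (spread (\<nu> t) + G * ?K))"
    proof -
      have "norm (?g (Suc t) (Suc t) - ?g (Suc t) t)
          \<le> L * (norm (x (Suc t) i - x t i) + norm (\<nu> (Suc t) i - \<nu> t i))"
        by (rule grad2_lipschitz) (rule x_in)+
      also have "\<dots> \<le> L * (?K + (spread (\<nu> t) + G * ?K))"
        by (intro mult_left_mono add_mono norm_x_step_le norm_nu_step_le L)
      finally show ?thesis .
    qed
    moreover have "y (Suc t) i - (\<Sum>j\<in>UNIV. A t $ i $ j *\<^sub>R y t j)
        = (?g (Suc t) t - ?g t t) + (?g (Suc t) (Suc t) - ?g (Suc t) t)"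
      by (simp add: y_Suc)
    ultimately show "norm (y (Suc t) i - (\<Sum>j\<in>UNIV. A t $ i $ j *\<^sub>R y t j)) \<le> ?b t"
      using norm_triangle_ineq[of "?g (Suc t) t - ?g t t" "?g (Suc t) (Suc t) - ?g (Suc t) t"] by simp
  qed
  have "(\<Sum>t<T. spread (\<nu> t)) \<le> (\<Sum>t\<le>T. spread (\<nu> t))"
    by (intro sum_mono2) (auto simp: spread_nonneg)
  then have "L * (real T * ?K + (\<Sum>t<T. spread (\<nu> t)) + real T * (G * ?K))
      \<le> L * (real T * ?K + (\<Sum>t\<le>T. spread (\<nu> t)) + real T * (G * ?K))"
    by (intro mult_left_mono L) simp
  moreover have "(\<Sum>t<T. ?b t) = (\<Sum>t<T. grad_drift X f t)
      + L * (real T * ?K + (\<Sum>t<T. spread (\<nu> t)) + real T * (G * ?K))"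
    by (simp add: sum.distrib flip: sum_distrib_left)
  ultimately have "(\<Sum>t<T. ?b t) \<le> 2 * G * real CARD('v) + grad_variation X f T
      + L * (real T * ?K + (\<Sum>t\<le>T. spread (\<nu> t)) + real T * (G * ?K))"
    using sum_grad_drift_le[of T] by simp
  with spread_y_start have "mixing * (spread (y 0) + 4 * (\<Sum>t<T. ?b t))
      \<le> mixing * (2 * G + 4 * (2 * G * real CARD('v) + grad_variation X f T
        + L * (real T * ?K + (\<Sum>t\<le>T. spread (\<nu> t)) + real T * (G * ?K))))"
    by (intro mult_left_mono mixing_nonneg) simp
  then show ?thesis using y.sum_spread_le[of T] by linarith
qed

section \<open>From disagreement to regret\<close>

lemma block_x: "block own i (col own (x t)) = x t i"
  by (rule block_col_X) (rule x_in)

text \<open>By gradient tracking, the averages of \<open>\<nu>\<close> and \<open>y\<close> are the aggregate and the average of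
  the second gradients, so only consensus errors enter.\<close>
lemma norm_direction_error_le:
  "norm (loss_gradient t (col own (x t)) i - direction t i)
    \<le> (L + G * L) * spread (\<nu> t) + G * spread (y t)"
proof -
  let ?N = "1 / real CARD('v)"
  define z where "z = aggregate own \<psi> (col own (x t))"
  have z: "z = ?N *\<^sub>R (\<Sum>j\<in>UNIV. \<nu> t j)"
    by (simp add: z_def aggregate_def block_x sum_nu)
  have z_le: "norm (z - \<nu> t j) \<le> spread (\<nu> t)" for j
    unfolding z using norm_diff_mean_le_spread[of "\<nu> t" j] by (simp add: norm_minus_commute)
  let ?s = "?N *\<^sub>R (\<Sum>j\<in>UNIV. grad2 (f j t) (x t j) z)"
  let ?m = "?N *\<^sub>R (\<Sum>j\<in>UNIV. y t j)"
  have "norm (grad1 (f i t) (x t i) z - grad1 (f i t) (x t i) (\<nu> t i)) \<le> L * norm (z - \<nu> t i)"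
    using grad1_lipschitz[OF x_in[of t i] x_in[of t i], of t z "\<nu> t i"] by simp
  also have "\<dots> \<le> L * spread (\<nu> t)" by (intro mult_left_mono z_le L)
  finally have e1: "norm (grad1 (f i t) (x t i) z - grad1 (f i t) (x t i) (\<nu> t i)) \<le> L * spread (\<nu> t)" .
  have "norm (0 - (\<Sum>j\<in>UNIV. ?N *\<^sub>R (grad2 (f j t) (x t j) z - grad2 (f j t) (x t j) (\<nu> t j)))) \<le> L * spread (\<nu> t)"
  proof (rule norm_diff_weighted_sum_le)
    fix j
    have "norm (grad2 (f j t) (x t j) z - grad2 (f j t) (x t j) (\<nu> t j)) \<le> L * norm (z - \<nu> t j)"
      using grad2_lipschitz[OF x_in[of t j] x_in[of t j], of t z "\<nu> t j"] by simp
    also have "\<dots> \<le> L * spread (\<nu> t)" by (intro mult_left_mono z_le L)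
    finally show "norm (0 - (grad2 (f j t) (x t j) z - grad2 (f j t) (x t j) (\<nu> t j))) \<le> L * spread (\<nu> t)"
      by (simp add: norm_minus_commute)
  qed auto
  then have "norm (?s - ?m) \<le> L * spread (\<nu> t)"
    by (simp add: sum_y sum_subtractf scaleR_diff_right scaleR_sum_right norm_minus_commute)
  moreover have "norm (?m - y t i) \<le> spread (y t)"
    using norm_diff_mean_le_spread[of "y t" i] by (simp add: norm_minus_commute)
  ultimately have "norm (?s - y t i) \<le> L * spread (\<nu> t) + spread (y t)"
    using norm_triangle_ineq[of "?s - ?m" "?m - y t i"] by simp
  then have "G * norm (?s - y t i) \<le> G * (L * spread (\<nu> t) + spread (y t))"
    using G(1) by (intro mult_left_mono) auto
  then have e2: "norm (nabla (\<psi> i) (x t i) *v (?s - y t i)) \<le> G * (L * spread (\<nu> t) + spread (y t))"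
    using norm_nabla_mult_le[of i t "?s - y t i"] by linarith
  have "loss_gradient t (col own (x t)) i - direction t i
      = (grad1 (f i t) (x t i) z - grad1 (f i t) (x t i) (\<nu> t i)) + nabla (\<psi> i) (x t i) *v (?s - y t i)"
    unfolding loss_gradient_def direction_def block_x z_def[symmetric] matrix_vector_mult_diff_distrib
    by simp
  also have "norm \<dots> \<le> L * spread (\<nu> t) + G * (L * spread (\<nu> t) + spread (y t))"
    by (rule norm_triangle_mono[OF e1 e2])
  finally show ?thesis by (simp add: algebra_simps)
qed

text \<open>Convexity linearizes the regret. The gradient is split into \<open>direction\<close>,
  handled by the projected step, and an error paired with a vector of length at most
  \<open>2 * B\<close>.\<close>

lemma instantaneous_regret_le:
  "total_loss own \<psi> f t (col own (x t)) - total_loss own \<psi> f t (xstar t)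
    \<le> (\<Sum>i\<in>UNIV. (norm (x t i - block own i (xstar t)))\<^sup>2
          - (norm (x (Suc t) i - block own i (xstar t)))\<^sup>2) / (2 * \<alpha>)
      + real CARD('v) * (\<alpha> * direction_bound\<^sup>2 / 2
          + 2 * B * ((L + G * L) * spread (\<nu> t) + G * spread (y t)))"
proof -
  let ?z = "\<lambda>i. block own i (xstar t)"
  let ?\<epsilon> = "(L + G * L) * spread (\<nu> t) + G * spread (y t)"
  let ?d = "\<lambda>i. (norm (x t i - ?z i))\<^sup>2 - (norm (x (Suc t) i - ?z i))\<^sup>2"
  have "loss_gradient t (col own (x t)) i \<bullet> (x t i - ?z i)
      \<le> ?d i / (2 * \<alpha>) + (\<alpha> * direction_bound\<^sup>2 / 2 + 2 * B * ?\<epsilon>)" for i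
  proof -
    let ?e = "loss_gradient t (col own (x t)) i - direction t i"
    have "direction t i \<bullet> (x t i - ?z i) \<le> ?d i / (2 * \<alpha>) + \<alpha> * direction_bound\<^sup>2 / 2"
      unfolding x_Suc
      by (rule projected_step_inner_le[OF X_convex X_closed block_xstar stepsize norm_direction_le])
    moreover have "?e \<bullet> (x t i - ?z i) \<le> norm ?e * norm (x t i - ?z i)"
      by (rule norm_cauchy_schwarz)
    moreover have "norm ?e * norm (x t i - ?z i) \<le> ?\<epsilon> * (2 * B)"
      using norm_direction_error_le[of t i] norm_diff_X_le[OF x_in[of t i] block_xstar[of i t]]
      by (intro mult_mono') auto
    ultimately show ?thesis by (simp add: inner_diff_left mult.commute)
  qed
  then have "(\<Sum>i\<in>UNIV. loss_gradient t (col own (x t)) i \<bullet> (x t i - ?z i))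
      \<le> (\<Sum>i\<in>UNIV. ?d i / (2 * \<alpha>) + (\<alpha> * direction_bound\<^sup>2 / 2 + 2 * B * ?\<epsilon>))"
    by (rule sum_mono)
  also have "\<dots> = (\<Sum>i\<in>UNIV. ?d i) / (2 * \<alpha>) + real CARD('v) * (\<alpha> * direction_bound\<^sup>2 / 2 + 2 * B * ?\<epsilon>)"
    by (simp add: sum.distrib sum_divide_distrib)
  finally show ?thesis
    using total_loss_diff_le[of t "col own (x t)" "xstar t"] by (simp add: block_x)
qed

text \<open>The sum telescopes except that the comparator changes between rounds; each change costs
  at most \<open>4 * B\<close> times its length. The induction keeps the final negative distance to
  absorb the next term.\<close>

lemma telescoped_distance_le:
  "(\<Sum>t=1..T. (norm (x t i - block own i (xstar t)))\<^sup>2 - (norm (x (Suc t) i - block own i (xstar t)))\<^sup>2)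
    \<le> 4 * B\<^sup>2 + 4 * B * path_variation xstar T"
proof -
  let ?d = "\<lambda>t. (norm (x t i - block own i (xstar t)))\<^sup>2"
  have "(\<Sum>t=1..T. ?d t - (norm (x (Suc t) i - block own i (xstar t)))\<^sup>2)
    \<le> ?d 1 - ?d (Suc T) + 4 * B * path_variation xstar T"
  proof (induction T)
    case 0
    then show ?case by (simp add: path_variation_def)
  next
    case (Suc T)
    let ?p = "x (Suc (Suc T)) i - block own i (xstar (Suc (Suc T)))"
    let ?q = "x (Suc (Suc T)) i - block own i (xstar (Suc T))"
    have "(norm ?p)\<^sup>2 - (norm ?q)\<^sup>2 \<le> 2 * (2 * B) * norm (?p - ?q)"
      by (intro power2_norm_diff_le norm_diff_X_le[of _ i] x_in block_xstar)
    also have "norm (?p - ?q) = norm (block own i (xstar (Suc (Suc T)) - xstar (Suc T)))"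
      by (simp add: block_diff norm_minus_commute)
    also have "2 * (2 * B) * \<dots> \<le> 2 * (2 * B) * norm (xstar (Suc (Suc T)) - xstar (Suc T))"
      using B(1) by (intro mult_left_mono norm_block_le) auto
    finally show ?case using Suc.IH by (simp add: path_variation_def algebra_simps)
  qed
  moreover have "?d 1 \<le> (2 * B)\<^sup>2"
    by (intro power_mono norm_diff_X_le[of _ i] x_in block_xstar) auto
  then have "?d 1 \<le> 4 * B\<^sup>2" by (simp add: power_mult_distrib)
  moreover have "0 \<le> ?d (Suc T)" by simp
  ultimately show ?thesis by linarith
qed

lemma dynamic_regret_le:
  "dynamic_regret own \<psi> f xstar x T
    \<le> real CARD('v) * (2 * B\<^sup>2 + 2 * B) * ((1 + path_variation xstar T) / \<alpha>)
      + real CARD('v) * (direction_bound\<^sup>2 / 2 * (\<alpha> * real T)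
          + 2 * B * ((L + G * L) * (\<Sum>t\<le>T. spread (\<nu> t)) + G * (\<Sum>t\<le>T. spread (y t))))"
proof -
  let ?V = "path_variation xstar T"
  let ?d = "\<lambda>t i. (norm (x t i - block own i (xstar t)))\<^sup>2 - (norm (x (Suc t) i - block own i (xstar t)))\<^sup>2"
  have "dynamic_regret own \<psi> f xstar x T \<le> (\<Sum>t=1..T. (\<Sum>i\<in>UNIV. ?d t i) / (2 * \<alpha>)
      + real CARD('v) * (\<alpha> * direction_bound\<^sup>2 / 2
          + 2 * B * ((L + G * L) * spread (\<nu> t) + G * spread (y t))))"
    unfolding dynamic_regret_def sum_subtractf[symmetric]
    by (intro sum_mono instantaneous_regret_le)
  also have "\<dots> = (\<Sum>i\<in>UNIV. \<Sum>t=1..T. ?d t i) / (2 * \<alpha>)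
      + real CARD('v) * (direction_bound\<^sup>2 / 2 * (\<alpha> * real T)
          + 2 * B * ((L + G * L) * (\<Sum>t=1..T. spread (\<nu> t)) + G * (\<Sum>t=1..T. spread (y t))))"
  proof -
    \<comment> \<open>The sums over rounds and agents are exchanged so that each agent's distances
      telescope.\<close>
    have "(\<Sum>t=1..T. (\<Sum>i\<in>UNIV. ?d t i) / (2 * \<alpha>)) = (\<Sum>i\<in>UNIV. \<Sum>t=1..T. ?d t i) / (2 * \<alpha>)"
      unfolding sum_divide_distrib[symmetric] by (subst sum.swap) (rule refl)
    then show ?thesis
      by (simp only: sum.distrib sum_distrib_left[symmetric]) simp
  qed
  also have "(\<Sum>i\<in>UNIV. \<Sum>t=1..T. ?d t i) / (2 * \<alpha>)
      \<le> real CARD('v) * (2 * B\<^sup>2 + 2 * B) * ((1 + ?V) / \<alpha>)"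
  proof -
    have "(\<Sum>i\<in>UNIV. \<Sum>t=1..T. ?d t i) \<le> (\<Sum>i\<in>(UNIV::'v set). 4 * B\<^sup>2 + 4 * B * ?V)"
      by (intro sum_mono telescoped_distance_le)
    also have "\<dots> = real CARD('v) * (4 * B\<^sup>2 + 4 * B * ?V)" by simp
    also have "\<dots> \<le> real CARD('v) * ((4 * B\<^sup>2 + 4 * B) * (1 + ?V))"
      using B(1) path_variation_nonneg[of T] by (intro mult_left_mono) (auto simp: algebra_simps)
    finally have "(\<Sum>i\<in>UNIV. \<Sum>t=1..T. ?d t i) / (2 * \<alpha>)
        \<le> real CARD('v) * ((4 * B\<^sup>2 + 4 * B) * (1 + ?V)) / (2 * \<alpha>)"
      using stepsize by (intro divide_right_mono) auto
    also have "\<dots> = real CARD('v) * (2 * B\<^sup>2 + 2 * B) * ((1 + ?V) / \<alpha>)"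
      using stepsize by (simp add: field_simps)
    finally show ?thesis .
  qed
  \<comment> \<open>Round 0 is added to the nonnegative spreads to match the consensus
    bounds.\<close>
  also have "real CARD('v) * (direction_bound\<^sup>2 / 2 * (\<alpha> * real T)
          + 2 * B * ((L + G * L) * (\<Sum>t=1..T. spread (\<nu> t)) + G * (\<Sum>t=1..T. spread (y t))))
      \<le> real CARD('v) * (direction_bound\<^sup>2 / 2 * (\<alpha> * real T)
          + 2 * B * ((L + G * L) * (\<Sum>t\<le>T. spread (\<nu> t)) + G * (\<Sum>t\<le>T. spread (y t))))"
    using B(1) G(1) L
    by (intro mult_left_mono add_left_mono add_mono sum_mono2) (auto simp: spread_nonneg)
  finally show ?thesis by simp
qed

text \<open>The iterates are feasible and the comparators minimize round by round; this turns the
  upper bound into one on the absolute value.\<close>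

lemma dynamic_regret_nonneg: "0 \<le> dynamic_regret own \<psi> f xstar x T"
  unfolding dynamic_regret_def
  by (simp add: sum_mono total_loss_xstar_le col_in_joint_set x_in)

end

section \<open>A regret bound with uniform constants\<close>

context odgt_problem
begin

text \<open>The constants precede the stepsize, the run and the horizon in the quantifier order, so
  the stepsize may later depend on \<open>T\<close>.\<close>

lemma dynamic_regret_le_stepsize:
  "\<exists>c\<^sub>0\<ge>0. \<exists>c\<^sub>1\<ge>0. \<exists>c\<^sub>2\<ge>0. \<exists>c\<^sub>3. \<forall>\<alpha>>0. \<forall>x \<nu> y T. odgt_run X \<psi> f A (\<lambda>_. \<alpha>) x \<nu> y \<longrightarrow>
    \<bar>dynamic_regret own \<psi> f xstar x T\<bar>
      \<le> c\<^sub>0 + c\<^sub>1 * ((1 + path_variation xstar T) / \<alpha>) + c\<^sub>2 * (\<alpha> * real T) + c\<^sub>3 * grad_variation X f T"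
proof -
  define N where "N = real CARD('v)"
  define K where "K = direction_bound"
  define P where "P = initial_spread_bound"
  define m where "m = mixing"
  \<comment> \<open>These are the coefficients obtained by inserting the bound for
    \<open>\<nu>\<close> into the one for \<open>y\<close> and both into the regret: constant part,
    \<open>(1 + path_variation xstar T) / \<alpha>\<close>, \<open>\<alpha> * T\<close> and gradient
    variation.\<close>
  define c\<^sub>0 where "c\<^sub>0 = N * (2 * B * ((L + G * L) * (m * P) + G * (m * (2 * G + 4 * (2 * G * N + L * (m * P))))))"
  define c\<^sub>1 where "c\<^sub>1 = N * (2 * B\<^sup>2 + 2 * B)"
  define c\<^sub>2 where "c\<^sub>2 = N * (K\<^sup>2 / 2 + 2 * B * ((L + G * L) * (m * (4 * (G * K)))
    + G * (m * (4 * (L * (K + m * (4 * (G * K)) + G * K))))))"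
  define c\<^sub>3 where "c\<^sub>3 = N * (2 * B * (G * (m * 4)))"
  have nonneg: "0 \<le> N" "0 \<le> K" "0 \<le> P" "0 \<le> m" "0 \<le> B" "0 \<le> G" "0 \<le> L"
    using direction_bound_nonneg mixing_nonneg B(1) G(1) L spread_nonneg
    by (auto simp: N_def K_def P_def m_def initial_spread_bound_def intro!: add_nonneg_nonneg)
  have bound: "\<bar>dynamic_regret own \<psi> f xstar x T\<bar> \<le> c\<^sub>0 + c\<^sub>1 * ((1 + path_variation xstar T) / \<alpha>)
      + c\<^sub>2 * (\<alpha> * real T) + c\<^sub>3 * grad_variation X f T"
    if "0 < \<alpha>" "odgt_run X \<psi> f A (\<lambda>_. \<alpha>) x \<nu> y" for \<alpha> x \<nu> y T
  proof -
    interpret odgt_execution A E Q a own X \<psi> f xstar B L G \<alpha> x \<nu> y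
      using that by unfold_locales
    let ?V = "grad_variation X f T"
    define \<tau> where "\<tau> = \<alpha> * real T"
    define S where "S = (\<Sum>t\<le>T. spread (\<nu> t))"
    define S' where "S' = (\<Sum>t\<le>T. spread (y t))"
    have S: "S \<le> m * (P + 4 * (G * K * \<tau>))"
      using sum_spread_nu_le[of T] unfolding S_def m_def P_def K_def \<tau>_def by (simp only: mult_ac)
    have "S' \<le> m * (2 * G + 4 * (2 * G * N + ?V + L * (K * \<tau> + S + G * K * \<tau>)))"
      using sum_spread_y_le[of T] unfolding S_def S'_def m_def N_def K_def \<tau>_def by (simp only: mult_ac)
    also have "\<dots> \<le> m * (2 * G + 4 * (2 * G * N + ?V + L * (K * \<tau> + m * (P + 4 * (G * K * \<tau>)) + G * K * \<tau>)))"
      using S nonneg by (intro mult_left_mono add_mono order_refl) auto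
    finally have S': "S' \<le> \<dots>" .
    have "dynamic_regret own \<psi> f xstar x T \<le> c\<^sub>1 * ((1 + path_variation xstar T) / \<alpha>)
        + N * (K\<^sup>2 / 2 * \<tau> + 2 * B * ((L + G * L) * S + G * S'))"
      using dynamic_regret_le[of T] unfolding c\<^sub>1_def N_def K_def S_def S'_def \<tau>_def .
    also have "N * (K\<^sup>2 / 2 * \<tau> + 2 * B * ((L + G * L) * S + G * S'))
        \<le> N * (K\<^sup>2 / 2 * \<tau> + 2 * B * ((L + G * L) * (m * (P + 4 * (G * K * \<tau>)))
          + G * (m * (2 * G + 4 * (2 * G * N + ?V + L * (K * \<tau> + m * (P + 4 * (G * K * \<tau>)) + G * K * \<tau>))))))"
      using S S' nonneg by (intro mult_left_mono add_mono order_refl) auto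
    also have "\<dots> = c\<^sub>0 + c\<^sub>2 * \<tau> + c\<^sub>3 * ?V"
      unfolding c\<^sub>0_def c\<^sub>2_def c\<^sub>3_def by (simp add: algebra_simps)
    finally show ?thesis using dynamic_regret_nonneg[of T] by (simp add: \<tau>_def)
  qed
  have "0 \<le> c\<^sub>0" "0 \<le> c\<^sub>1" "0 \<le> c\<^sub>2"
    using nonneg by (simp_all add: c\<^sub>0_def c\<^sub>1_def c\<^sub>2_def)
  with bound show ?thesis by blast
qed

end

text \<open>The stepsize balances the terms \<open>(1 + V) / \<alpha>\<close> and \<open>\<alpha> * T\<close> of the regret bound.\<close>
lemma stepsize_balance:
  fixes T V W D :: real
  assumes T: "0 < T" and V: "0 \<le> V" and W: "0 \<le> W" "W \<le> D\<^sup>2 * T" and D: "0 \<le> D"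
  defines "\<alpha> \<equiv> sqrt ((1 + V) / (T + W))"
  shows "0 < \<alpha>"
    and "(1 + V) / \<alpha> \<le> (1 + D) * sqrt T + sqrt (T * V) + sqrt (V * W)"
    and "\<alpha> * T \<le> sqrt T + sqrt (T * V)"
proof -
  have sV: "sqrt (1 + V) \<le> 1 + sqrt V" using sqrt_add_le_add_sqrt[of 1 V] V by simp
  \<comment> \<open>The linear growth of \<open>W\<close> lets \<open>sqrt W\<close> be absorbed
    into a multiple of \<open>sqrt T\<close>.\<close>
  have sW: "sqrt W \<le> D * sqrt T"
    using real_sqrt_le_mono[OF W(2)] D by (simp add: real_sqrt_mult)
  show "0 < \<alpha>" using T V W by (simp add: \<alpha>_def)
  have "(1 + V) / \<alpha> = (1 + V) / sqrt (1 + V) * sqrt (T + W)"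
    by (simp add: \<alpha>_def real_sqrt_divide)
  also have "\<dots> = sqrt (1 + V) * sqrt (T + W)" using V by (simp add: real_div_sqrt)
  also have "\<dots> \<le> (1 + sqrt V) * (sqrt T + sqrt W)"
    using T V W by (intro mult_mono sV sqrt_add_le_add_sqrt) auto
  also have "\<dots> = sqrt T + sqrt W + sqrt (T * V) + sqrt (V * W)"
    by (simp add: real_sqrt_mult algebra_simps)
  finally show "(1 + V) / \<alpha> \<le> (1 + D) * sqrt T + sqrt (T * V) + sqrt (V * W)"
    using sW by (simp add: algebra_simps)
  \<comment> \<open>Dropping \<open>W\<close> from the denominator only enlarges the
    stepsize.\<close>
  have "\<alpha> \<le> sqrt ((1 + V) / T)"
    unfolding \<alpha>_def using T V W by (intro real_sqrt_le_mono divide_left_mono) auto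
  then have "\<alpha> * T \<le> sqrt ((1 + V) / T) * T" using T by (intro mult_right_mono) auto
  also have "\<dots> = sqrt (1 + V) * sqrt T"
    using T by (simp add: real_sqrt_divide real_div_sqrt field_simps)
  also have "\<dots> \<le> (1 + sqrt V) * sqrt T" using T sV by (intro mult_right_mono) auto
  finally show "\<alpha> * T \<le> sqrt T + sqrt (T * V)"
    by (simp add: real_sqrt_mult algebra_simps)
qed

theorem theorem2:
  fixes own :: "'n::finite \<Rightarrow> 'v::finite"
    and X :: "'v \<Rightarrow> (real^'n) set"
    and \<psi> :: "'v \<Rightarrow> real^'n \<Rightarrow> real^'d::finite"
    and f :: "'v \<Rightarrow> nat \<Rightarrow> real^'n \<Rightarrow> real^'d \<Rightarrow> real"
    and E :: "nat \<Rightarrow> ('v \<times> 'v) set"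
    and A :: "nat \<Rightarrow> real^'v^'v"
    and xstar :: "nat \<Rightarrow> real^'n"
    and B L\<^sub>1 L\<^sub>2 G a :: real
    and Q :: nat
  assumes X_space: "\<And>i. X i \<subseteq> block_space own i"
    and psi_block: "\<And>i. depends_on_block own i (\<psi> i)"
    and psi_diff: "\<And>i. \<psi> i differentiable_on UNIV"
    and f_block: "\<And>i t z. depends_on_block own i (\<lambda>u. f i t u z)"
    and f_diff: "\<And>i t. (\<lambda>(u, z). f i t u z) differentiable_on UNIV"
    and weights_nonneg: "\<And>t i j. A t $ i $ j \<ge> 0"
    and weights_edge: "\<And>t i j. i \<noteq> j \<Longrightarrow> (j, i) \<in> E t \<Longrightarrow> A t $ i $ j > 0"
    and weights_no_edge: "\<And>t i j. i \<noteq> j \<Longrightarrow> (j, i) \<notin> E t \<Longrightarrow> A t $ i $ j = 0"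
    and xstar: "\<And>t. is_arg_min (total_loss own \<psi> f t) (\<lambda>x. x \<in> joint_set own X) (xstar t)"
    and X_set: "\<And>i. X i \<noteq> {} \<and> convex (X i) \<and> compact (X i)"
    and B: "B > 0" "\<And>i u. u \<in> X i \<Longrightarrow> norm u \<le> B"
    and f_convex: "\<And>t. convex_on UNIV (total_loss own \<psi> f t)"
    and lipschitz1: "\<And>t x x' y y'. x \<in> joint_set own X \<Longrightarrow> x' \<in> joint_set own X \<Longrightarrow>
      norm (stacked_grad1 own f t x y - stacked_grad1 own f t x' y')
        \<le> L\<^sub>1 * (norm (x - x') + norm (y - y'))"
    and lipschitz2: "\<And>t x x' y y'. x \<in> joint_set own X \<Longrightarrow> x' \<in> joint_set own X \<Longrightarrow>
      norm (stacked_grad2 own f t x y - stacked_grad2 own f t x' y')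
        \<le> L\<^sub>1 * (norm (x - x') + norm (y - y'))"
    and G: "G > 0"
      "\<And>t x y. x \<in> joint_set own X \<Longrightarrow> norm (stacked_grad1 own f t x y) \<le> G"
      "\<And>t x y. x \<in> joint_set own X \<Longrightarrow> norm (stacked_grad2 own f t x y) \<le> G"
      "\<And>i x. x \<in> joint_set own X \<Longrightarrow> matrix_norm (nabla (\<psi> i) (block own i x)) \<le> G"
    and psi_lipschitz: "\<And>i u u'. u \<in> X i \<Longrightarrow> u' \<in> X i \<Longrightarrow>
      matrix_norm (nabla (\<psi> i) u - nabla (\<psi> i) u') \<le> L\<^sub>2 * norm (u - u')"
    and connected: "Q > 0" "\<And>k i j. (i, j) \<in> (\<Union>l\<in>{0..Q-1}. E (k + l))\<^sup>*"
    and stochastic: "\<And>t. doubly_stochastic (A t)"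
    and a: "0 < a" "a < 1"
      "\<And>t i j. A t $ i $ j > 0 \<Longrightarrow> A t $ i $ j \<ge> a"
      "\<And>t i. A t $ i $ i \<ge> a"
  shows "\<exists>C\<^sub>1 C\<^sub>2 C\<^sub>3 C\<^sub>4. \<forall>T\<ge>1. \<forall>x \<nu> y.
    odgt_run X \<psi> f A
      (\<lambda>_. sqrt ((1 + path_variation xstar T) / (real T + grad_variation_sq X f T))) x \<nu> y \<longrightarrow>
    \<bar>dynamic_regret own \<psi> f xstar x T\<bar>
      \<le> C\<^sub>1 * sqrt (real T)
        + C\<^sub>2 * sqrt (real T * path_variation xstar T)
        + C\<^sub>3 * grad_variation X f T
        + C\<^sub>4 * sqrt (path_variation xstar T * grad_variation_sq X f T)"
proof -
  \<comment> \<open>The given Lipschitz constant carries no sign, so its absolute value takes its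
    place.\<close>
  have lip: "L\<^sub>1 * (p + q) \<le> \<bar>L\<^sub>1\<bar> * (p + q)" if "0 \<le> p" "0 \<le> q" for p q
    using that by (intro mult_right_mono) auto
  interpret odgt_problem A E Q a own X \<psi> f xstar B "\<bar>L\<^sub>1\<bar>" G
  proof unfold_locales
    fix t x x' and y y' :: "real^'d^'v"
    assume "x \<in> joint_set own X" "x' \<in> joint_set own X"
    then show "norm (stacked_grad1 own f t x y - stacked_grad1 own f t x' y')
        \<le> \<bar>L\<^sub>1\<bar> * (norm (x - x') + norm (y - y'))"
      and "norm (stacked_grad2 own f t x y - stacked_grad2 own f t x' y')
        \<le> \<bar>L\<^sub>1\<bar> * (norm (x - x') + norm (y - y'))"
      using lipschitz1 lipschitz2 lip by (meson norm_ge_zero order_trans)+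
  qed (fact assms | simp)+
  obtain c\<^sub>0 c\<^sub>1 c\<^sub>2 c\<^sub>3 where c: "0 \<le> c\<^sub>0" "0 \<le> c\<^sub>1" "0 \<le> c\<^sub>2"
    and regret: "\<And>\<alpha> x \<nu> y T. 0 < \<alpha> \<Longrightarrow> odgt_run X \<psi> f A (\<lambda>_. \<alpha>) x \<nu> y \<Longrightarrow>
      \<bar>dynamic_regret own \<psi> f xstar x T\<bar>
        \<le> c\<^sub>0 + c\<^sub>1 * ((1 + path_variation xstar T) / \<alpha>) + c\<^sub>2 * (\<alpha> * real T) + c\<^sub>3 * grad_variation X f T"
    using dynamic_regret_le_stepsize by blast
  \<comment> \<open>This is the uniform bound on the drift of one round.\<close>
  define D where "D = 2 * G * real CARD('v)"
  show ?thesis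
  proof (intro exI allI impI)
    fix T :: nat and x \<nu> y
    let ?V = "path_variation xstar T" and ?W = "grad_variation_sq X f T"
    let ?\<alpha> = "sqrt ((1 + ?V) / (real T + ?W))"
    assume T: "1 \<le> T" and run: "odgt_run X \<psi> f A (\<lambda>_. ?\<alpha>) x \<nu> y"
    have "0 \<le> D" using G(1) by (simp add: D_def)
    note balance = stepsize_balance[of "real T" ?V ?W D, OF _ path_variation_nonneg
        grad_variation_sq_bounds[of T, folded D_def] this]
    have "0 < ?\<alpha>" using balance(1) T by simp
    then have "\<bar>dynamic_regret own \<psi> f xstar x T\<bar>
        \<le> c\<^sub>0 + c\<^sub>1 * ((1 + ?V) / ?\<alpha>) + c\<^sub>2 * (?\<alpha> * real T) + c\<^sub>3 * grad_variation X f T"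
      using run by (rule regret)
    \<comment> \<open>As \<open>T \<ge> 1\<close>, the constant \<open>c\<^sub>0\<close> is at most
      \<open>c\<^sub>0 * sqrt T\<close>; the balanced stepsize bounds the other two terms.\<close>
    also have "\<dots> \<le> c\<^sub>0 * sqrt (real T) + c\<^sub>1 * ((1 + D) * sqrt (real T) + sqrt (real T * ?V) + sqrt (?V * ?W))
        + c\<^sub>2 * (sqrt (real T) + sqrt (real T * ?V)) + c\<^sub>3 * grad_variation X f T"
      using T c balance(2,3) by (intro add_mono mult_left_mono order_refl mult_le_cancel_left1[THEN iffD2]) auto
    also have "\<dots> = (c\<^sub>0 + c\<^sub>1 * (1 + D) + c\<^sub>2) * sqrt (real T) + (c\<^sub>1 + c\<^sub>2) * sqrt (real T * ?V)
        + c\<^sub>3 * grad_variation X f T + c\<^sub>1 * sqrt (?V * ?W)"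
      by (simp add: algebra_simps)
    finally show "\<bar>dynamic_regret own \<psi> f xstar x T\<bar>
        \<le> (c\<^sub>0 + c\<^sub>1 * (1 + D) + c\<^sub>2) * sqrt (real T) + (c\<^sub>1 + c\<^sub>2) * sqrt (real T * ?V)
          + c\<^sub>3 * grad_variation X f T + c\<^sub>1 * sqrt (?V * ?W)" .
  qed
qed

end
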